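(* Let $n$ be even and let $1 \le a, b < \frac{n}{2}$. Then $T_4(n,a,b)$ is a nut graph if and only if (i) $\gcd\left(\frac{n}{2}, a, b\right) = 1$; (ii) if $4 \nmid n$, then at least one of $a, b$ is even; (iii) if $4 \mid n$, then $a$ and $b$ are of different parities; (iv) if $10 \mid n$, then at least one of $a, b, a-b, a+b$ is divisible by $5$.
   Context: All graphs are simple. A nut graph is a graph whose adjacency matrix has the eigenvalue $0$ with multiplicity one (nullity one) and whose null space is spanned by a vector with no zero entries. For $n$ even, $T_4(n,a,b)$ is the graph with vertex set $\{x_j, y_j, z_j : j \in \mathbb{Z}_n\}$ (indices modulo $n$) and edge set $\{x_j x_{j+a}, x_j z_j, y_j y_{j+b}, y_j z_j, z_j z_{j+n/2} : j \in \mathbb{Z}_n\}$. *)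

theory Defs
  imports
    Jordan_Normal_Form.Matrix_Kernel
    "HOL-Library.Countable_Set"
begin

type_synonym 'v ugraph = "'v set \<times> 'v set set"

abbreviation vertices :: "'v ugraph \<Rightarrow> 'v set" where
  "vertices G \<equiv> fst G"

abbreviation edges :: "'v ugraph \<Rightarrow> 'v set set" where
  "edges G \<equiv> snd G"

definition simple_graph :: "'v ugraph \<Rightarrow> bool" where
  "simple_graph G \<longleftrightarrow>
     finite (vertices G) \<and>
     (\<forall>e \<in> edges G. \<exists>u v. u \<in> vertices G \<and> v \<in> vertices G \<and> u \<noteq> v \<and> e = {u, v})"

text \<open>
  For a finite vertex set \<open>V\<close>, the library function \<open>from_nat_into V\<close> is a bijection from
  \<open>{..<card V}\<close> onto \<open>V\<close>; it fixes the order in which the vertices index rows and columns.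
  Another order conjugates the matrix by a permutation matrix, so the predicate \<open>nut_graph\<close>
  below does not depend on this choice.
\<close>
definition adjacency_matrix :: "'v ugraph \<Rightarrow> real mat" where
  "adjacency_matrix G = mat (card (vertices G)) (card (vertices G))
     (\<lambda>(i, j). if {from_nat_into (vertices G) i, from_nat_into (vertices G) j} \<in> edges G
               then 1 else 0)"

text \<open>
  The multiplicity of the eigenvalue 0 is the nullity of the adjacency matrix (for a real
  symmetric matrix, geometric and algebraic multiplicities agree).
\<close>
definition nut_graph :: "'v ugraph \<Rightarrow> bool" where
  "nut_graph G \<longleftrightarrow>
     simple_graph G \<and>
     kernel_dim (adjacency_matrix G) = 1 \<and>
     (\<exists>v \<in> carrier_vec (card (vertices G)).
        mat_kernel (adjacency_matrix G)
          = LinearCombinations.module.span class_ring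
              (module_vec TYPE(real) (card (vertices G))) {v} \<and>
        (\<forall>i < card (vertices G). v $ i \<noteq> 0))"

text \<open>The index set \<open>\<int>\<^sub>n\<close> is represented by the residues \<open>{..<n}\<close>.\<close>
datatype t4_vertex = X nat | Y nat | Z nat

definition T4 :: "nat \<Rightarrow> nat \<Rightarrow> nat \<Rightarrow> t4_vertex ugraph" where
  "T4 n a b =
     (X ` {..<n} \<union> Y ` {..<n} \<union> Z ` {..<n},
      (\<Union>j<n. {{X j, X ((j + a) mod n)},
               {X j, Z j},
               {Y j, Y ((j + b) mod n)},
               {Y j, Z j},
               {Z j, Z ((j + n div 2) mod n)}}))"

end

theory Submission
  imports
    Defs
    Jordan_Normal_Form.Char_Poly
    "HOL-Number_Theory.Cong"
begin

text \<open>
  The adjacency matrix commutes with the rotation of the indices, so on the characters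
  \<open>j \<mapsto> \<zeta>\<^sup>j\<close>, \<open>\<zeta> = exp(2\<pi>ik/n)\<close>, it acts by \<open>3 \<times> 3\<close> blocks. With
  \<open>A = 2 cos(2\<pi>ak/n)\<close>, \<open>B = 2 cos(2\<pi>bk/n)\<close> and \<open>s = (-1)\<^sup>k\<close>, the block is singular iff
  \<open>sAB = A + B\<close>. The block of \<open>k = 0\<close> contributes the null vector with values \<open>1, 1, -2\<close>;
  hence the graph is a nut graph iff no other block is singular. Replacing \<open>a, b\<close> by
  \<open>a + n/2, b + n/2\<close> absorbs the sign: \<open>AB = A + B\<close>, that is \<open>(A - 1)(B - 1) = 1\<close>. If \<open>A\<close>
  comes from a primitive root of unity of order \<open>N > 1\<close>, then Galois conjugation turns it into
  \<open>2 cos(2\<pi>/N)\<close> while \<open>\<bar>B\<bar> \<le> 2\<close>; this forces \<open>N \<le> 5\<close>, and only \<open>A = B = 2\<close>, \<open>A = B = 0\<close>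
  and the two conjugates \<open>(-1 \<plusminus> \<surd>5)/2\<close> survive. These three solutions account for the arithmetic conditions.
\<close>

subsection \<open>Conjugate roots of unity\<close>

abbreviation ipoly :: "int poly \<Rightarrow> complex \<Rightarrow> complex" where
  "ipoly q x \<equiv> poly (of_int_poly q) x"

lemma power_mod_root_of_unity:
  fixes x :: "'a::monoid_mult"
  assumes "x ^ n = 1"
  shows "x ^ (k mod n) = x ^ k"
  by (metis assms mod_mult_div_eq mult_1_right power_add power_mult power_one)

text \<open>Multiplication by \<open>q\<close> on Z[x]/(x^n - 1) is given by an integer matrix in
  the basis of powers of x. The powers of \<eta> form an eigenvector with eigenvalue
  \<open>ipoly q \<eta>\<close>, so this number is a root of a monic integer polynomial.\<close>

lemma algebraic_int_ipoly_root_of_unity: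
  assumes n: "n > 0" and eta: "\<eta> ^ n = 1"
  shows "algebraic_int (ipoly q \<eta>)"
proof -
  \<comment> \<open>Row \<open>i\<close> holds the coefficients of x^i * q after reducing exponents
    modulo \<open>n\<close>.\<close>
  define M :: "int mat" where "M = mat n n (\<lambda>(i, l). \<Sum>e\<le>degree q. if (e + i) mod n = l then poly.coeff q e else 0)"
  define v where "v = vec n (\<lambda>l. \<eta> ^ l)"
  let ?M = "map_mat of_int M :: complex mat"
  have M: "M \<in> carrier_mat n n" "?M \<in> carrier_mat n n" by (auto simp: M_def)
  note pow_mod = power_mod_root_of_unity[OF eta]
  have Mv: "?M *\<^sub>v v = ipoly q \<eta> \<cdot>\<^sub>v v"
  proof (rule eq_vecI)
    fix i assume "i < dim_vec (ipoly q \<eta> \<cdot>\<^sub>v v)"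
    then have i: "i < n" by (simp add: v_def)
    have "(?M *\<^sub>v v) $ i = (\<Sum>l<n. (\<Sum>e\<le>degree q. if (e + i) mod n = l then of_int (poly.coeff q e) else 0) * \<eta> ^ l)"
      using i by (simp add: M_def v_def scalar_prod_def atLeast0LessThan of_int_sum if_distrib cong: if_cong)
    also have "\<dots> = (\<Sum>l<n. \<Sum>e\<le>degree q. if (e + i) mod n = l then of_int (poly.coeff q e) * \<eta> ^ l else 0)"
      by (intro sum.cong refl) (auto simp: sum_distrib_right intro!: sum.cong)
    also have "\<dots> = (\<Sum>e\<le>degree q. \<Sum>l<n. if (e + i) mod n = l then of_int (poly.coeff q e) * \<eta> ^ l else 0)"
      by (rule sum.swap)
    also have "\<dots> = (\<Sum>e\<le>degree q. of_int (poly.coeff q e) * \<eta> ^ ((e + i) mod n))"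
      using n by (intro sum.cong refl) (simp add: sum.delta)
    also have "\<dots> = ipoly q \<eta> * \<eta> ^ i"
      by (simp add: pow_mod power_add poly_altdef sum_distrib_right mult.assoc)
    finally show "(?M *\<^sub>v v) $ i = (ipoly q \<eta> \<cdot>\<^sub>v v) $ i" using i by (simp add: v_def)
  qed (auto simp: M_def v_def)
  have "v $ 0 \<noteq> (0\<^sub>v n :: complex vec) $ 0" using n by (simp add: v_def)
  then have "v \<noteq> 0\<^sub>v n" by metis
  then have "eigenvalue ?M (ipoly q \<eta>)"
    unfolding eigenvalue_def eigenvector_def using Mv by (intro exI[of _ v]) (auto simp: v_def M_def)
  then have "poly (char_poly ?M) (ipoly q \<eta>) = 0"
    using eigenvalue_root_char_poly[OF M(2)] by blast
  then have "ipoly (char_poly M) (ipoly q \<eta>) = 0"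
    by (simp add: of_int_hom.char_poly_hom[OF M(1)])
  moreover have "monic (char_poly M)" using degree_monic_char_poly[OF M(1)] by simp
  ultimately show ?thesis unfolding algebraic_int_altdef_ipoly by blast
qed

section \<open>Frobenius congruences modulo a prime\<close>

lemma prime_dvd_freshman:
  fixes x y :: "'a::comm_ring_1"
  assumes p: "prime p"
  shows "of_nat p dvd (x + y) ^ p - (x ^ p + y ^ p)"
proof -
  have "p > 0" using p prime_gt_0_nat by blast
  have "(x + y) ^ p = (\<Sum>k\<le>p. of_nat (p choose k) * x ^ k * y ^ (p - k))" by (rule binomial_ring)
  also have "{..p} = insert 0 (insert p {1..<p})" using \<open>p > 0\<close> by auto
  also have "(\<Sum>k\<in>\<dots>. of_nat (p choose k) * x ^ k * y ^ (p - k)) =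
      y ^ p + (x ^ p + (\<Sum>k\<in>{1..<p}. of_nat (p choose k) * x ^ k * y ^ (p - k)))"
    using \<open>p > 0\<close> by (subst sum.insert; simp)+
  finally have "(x + y) ^ p - (x ^ p + y ^ p) = (\<Sum>k\<in>{1..<p}. of_nat (p choose k) * x ^ k * y ^ (p - k))"
    by simp
  moreover have "of_nat p dvd (of_nat (p choose k) * x ^ k * y ^ (p - k) :: 'a)" if "k \<in> {1..<p}" for k
  proof -
    have "p dvd p choose k" using dvd_choose_prime[of k p] that p by auto
    then obtain c where "p choose k = p * c" by (rule dvdE)
    then show ?thesis by (simp add: mult.assoc)
  qed
  ultimately show ?thesis by (auto intro: dvd_sum)
qed

text \<open>Fermat's little theorem, by induction from 0 in both directions: the binomial congruence
  with second summand 1 carries it from \<open>i\<close> to \<open>i + 1\<close> and back.\<close>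

lemma prime_dvd_int_power_diff:
  assumes "prime p" shows "int p dvd c ^ p - c"
proof (induction c rule: int_induct[where k = 0])
  case base then show ?case using assms prime_gt_0_nat by (simp add: power_0_left)
next
  case (step1 i)
  have "int p dvd ((i + 1) ^ p - (i ^ p + 1 ^ p)) + (i ^ p - i)"
    using prime_dvd_freshman[OF assms, of i 1] step1 by (intro dvd_add) auto
  also have "((i + 1) ^ p - (i ^ p + 1 ^ p)) + (i ^ p - i) = (i + 1) ^ p - (i + 1)" by simp
  finally show ?case .
next
  case (step2 i)
  have "int p dvd (i ^ p - i) - (((i - 1) + 1) ^ p - ((i - 1) ^ p + 1 ^ p))"
    using dvd_diff[OF step2(2) prime_dvd_freshman[OF assms, of "i - 1" 1]] by simp
  then show ?case by (simp add: algebra_simps)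
qed

text \<open>The Frobenius congruence q(x)^p = q(x^p) modulo p in Z[x], evaluated at \<eta>. The
  quotient stays an integer polynomial in \<eta>, so the difference lies in p Z[\<eta>]. Induction
  splits off the constant coefficient, to which Fermat applies.\<close>

lemma ipoly_power_prime:
  assumes p: "prime p"
  shows "\<exists>r. ipoly q \<eta> ^ p - ipoly q (\<eta> ^ p) = of_nat p * ipoly r \<eta>"
proof (induction q)
  case 0 show ?case using p prime_gt_0_nat by (intro exI[of _ 0]) simp
next
  case (pCons c q)
  then obtain r where r: "ipoly q \<eta> ^ p - ipoly q (\<eta> ^ p) = of_nat p * ipoly r \<eta>" by blast
  obtain s where s: "([:c:] + pCons 0 q) ^ p - ([:c:] ^ p + pCons 0 q ^ p) = of_nat p * s"
    using prime_dvd_freshman[OF p, of "[:c:]" "pCons 0 q"] by (auto simp: dvd_def)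
  obtain d where d: "c ^ p - c = int p * d" using prime_dvd_int_power_diff[OF p] by (auto simp: dvd_def)
  have "ipoly (([:c:] + pCons 0 q) ^ p - ([:c:] ^ p + pCons 0 q ^ p)) \<eta> = ipoly (of_nat p * s) \<eta>"
    by (simp only: s)
  then have s': "(of_int c + \<eta> * ipoly q \<eta>) ^ p - (of_int c ^ p + \<eta> ^ p * ipoly q \<eta> ^ p) = of_nat p * ipoly s \<eta>"
    by (simp add: hom_distribs power_mult_distrib)
  have d': "of_int c ^ p - of_int c = (of_nat p * of_int d :: complex)"
    using arg_cong[OF d, of "of_int :: int \<Rightarrow> complex"] by simp
  have "ipoly (pCons c q) \<eta> ^ p - ipoly (pCons c q) (\<eta> ^ p) =
     ((of_int c + \<eta> * ipoly q \<eta>) ^ p - (of_int c ^ p + \<eta> ^ p * ipoly q \<eta> ^ p))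
      + (of_int c ^ p - of_int c) + \<eta> ^ p * (ipoly q \<eta> ^ p - ipoly q (\<eta> ^ p))"
    by (simp add: hom_distribs algebra_simps)
  also have "\<dots> = of_nat p * (ipoly s \<eta> + of_int d + \<eta> ^ p * ipoly r \<eta>)"
    unfolding s' d' r by (simp add: algebra_simps)
  also have "\<dots> = of_nat p * ipoly (s + [:d:] + Polynomial.monom 1 p * r) \<eta>"
    by (simp add: hom_distribs poly_monom)
  finally show ?case by blast
qed

text \<open>If \<alpha> is nonzero, it divides a nonzero integer \<open>c\<close> within Z[\<eta>],
  namely the constant term of an integer polynomial vanishing at \<alpha>. Each prime in question
  then divides \<open>c\<close>, first in Z[\<eta>] and hence in the integers, which leaves only
  finitely many.\<close>

lemma ipoly_eq_0_of_infinitely_many_primes: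
  assumes n: "n > 0" and eta: "\<eta> ^ n = 1"
    and inf: "infinite {p. prime p \<and> (\<exists>r. \<alpha> = of_nat p * ipoly r \<eta>)}"
  shows "\<alpha> = 0"
proof (rule ccontr)
  assume nz: "\<alpha> \<noteq> 0"
  have "\<exists>q. \<alpha> = ipoly q \<eta>"
  proof -
    from inf obtain p r where "\<alpha> = of_nat p * ipoly r \<eta>" using not_finite_existsD by blast
    then have "\<alpha> = ipoly (of_nat p * r) \<eta>" by (simp add: hom_distribs)
    then show ?thesis by blast
  qed
  then obtain q where q: "\<alpha> = ipoly q \<eta>" by blast
  then have "algebraic_int \<alpha>" using algebraic_int_ipoly_root_of_unity[OF n eta] by simp
  then have "algebraic \<alpha>" by blast
  then obtain g where g: "poly.coeff g 0 \<noteq> 0" "ipoly g \<alpha> = 0"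
    using algebraicE'_nonzero[OF _ nz] by metis
  obtain c g' where g': "g = pCons c g'" by (cases g)
  have c: "of_int c = - \<alpha> * ipoly g' \<alpha>" "c \<noteq> 0"
    using g unfolding g' by (auto simp: hom_distribs eq_neg_iff_add_eq_0)
  have "{p. prime p \<and> (\<exists>r. \<alpha> = of_nat p * ipoly r \<eta>)} \<subseteq> {p. p dvd nat \<bar>c\<bar>}"
  proof safe
    fix p :: nat and r assume p: "prime p" and r: "\<alpha> = of_nat p * ipoly r \<eta>"
    have p0: "p > 0" using p prime_gt_0_nat by blast
    \<comment> \<open>This is \<open>c / p\<close> written as an integer polynomial in \<eta>: an
      algebraic integer that is rational, hence an integer.\<close>
    define w where "w = ipoly (- r * (g' \<circ>\<^sub>p q)) \<eta>"
    have "of_int c = - (of_nat p * ipoly r \<eta>) * ipoly g' (ipoly q \<eta>)"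
      using c(1) r q by metis
    then have cw: "of_int c = of_nat p * w"
      by (simp add: w_def hom_distribs poly_pcompose of_int_hom.map_poly_pcompose)
    then have "w = of_rat (of_int c / of_nat p)"
      using p0 by (simp add: of_rat_divide field_simps)
    then have "w \<in> \<rat>" by simp
    moreover have "algebraic_int w" unfolding w_def by (rule algebraic_int_ipoly_root_of_unity[OF n eta])
    ultimately have "w \<in> \<int>" by (rule rational_algebraic_int_is_int[rotated])
    then obtain z where z: "w = of_int z" by (auto elim: Ints_cases)
    have "(of_int c :: complex) = of_int (int p * z)" using cw z by simp
    then have "c = int p * z" by (simp only: of_int_eq_iff)
    then show "p dvd nat \<bar>c\<bar>" by (simp add: abs_mult nat_mult_distrib)
  qed
  moreover have "finite {p. p dvd nat \<bar>c\<bar>}" using c(2) by (intro finite_divisors_nat) simp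
  ultimately show False using inf finite_subset by blast
qed

text \<open>
  A prime \<open>l\<close> in the residue class of \<open>p\<close> modulo \<open>n\<close> divides
  \<open>q(\<eta>\<^sup>l) = q(\<eta>\<^sup>p)\<close>, so \<open>q(\<eta>\<^sup>p)\<close> vanishes as soon as the class contains
  infinitely many primes. All but finitely many \<open>p\<close> lie in such a class, which makes
  Dirichlet's theorem unnecessary.
\<close>
lemma ipoly_root_power_large_prime:
  assumes n: "n > 0"
  shows "\<exists>B. \<forall>p. prime p \<longrightarrow> p > B \<longrightarrow> (\<forall>\<eta> q. \<eta> ^ n = 1 \<longrightarrow> ipoly q \<eta> = 0 \<longrightarrow> ipoly q (\<eta> ^ p) = 0)"
proof -
  define C :: "nat \<Rightarrow> nat set" where "C r = {p. prime p \<and> p mod n = r}" for r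
  define F where "F = (\<Union>r\<in>{r. r < n \<and> finite (C r)}. C r)"
  have "finite F" unfolding F_def by (intro finite_UN_I) auto
  then obtain B where B: "\<forall>p\<in>F. p \<le> B" using finite_nat_set_iff_bounded_le by auto
  show ?thesis
  proof (rule exI[of _ B], intro allI impI)
    fix p \<eta> q assume p: "prime p" "p > B" and eta: "(\<eta>::complex) ^ n = 1" and q: "ipoly q \<eta> = 0"
    note pow_mod = power_mod_root_of_unity[OF eta]
    have "p \<in> C (p mod n)" using p by (simp add: C_def)
    moreover have "p \<notin> F" using B p by force
    ultimately have "infinite (C (p mod n))" using n unfolding F_def by auto
    moreover have "C (p mod n) \<subseteq> {l. prime l \<and> (\<exists>r. ipoly q (\<eta> ^ p) = of_nat l * ipoly r \<eta>)}"
    proof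
      fix l assume "l \<in> C (p mod n)"
      then have l: "prime l" "l mod n = p mod n" by (auto simp: C_def)
      then have "\<eta> ^ l = \<eta> ^ p" using pow_mod by metis
      moreover obtain r where "ipoly q \<eta> ^ l - ipoly q (\<eta> ^ l) = of_nat l * ipoly r \<eta>"
        using ipoly_power_prime[OF l(1)] by blast
      ultimately have "ipoly q (\<eta> ^ p) = of_nat l * ipoly (- r) \<eta>"
        using q l(1) prime_gt_0_nat by (simp add: hom_distribs power_0_left neg_eq_iff_add_eq_0 eq_neg_iff_add_eq_0 algebra_simps)
      with l show "l \<in> {l. prime l \<and> (\<exists>r. ipoly q (\<eta> ^ p) = of_nat l * ipoly r \<eta>)}" by blast
    qed
    ultimately have "infinite {l. prime l \<and> (\<exists>r. ipoly q (\<eta> ^ p) = of_nat l * ipoly r \<eta>)}"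
      using infinite_super by blast
    then show "ipoly q (\<eta> ^ p) = 0"
      by (rule ipoly_eq_0_of_infinitely_many_primes[OF n eta])
  qed
qed

text \<open>Take \<open>l\<close> to be the product of the primes that divide \<open>M\<close> but
  not \<open>j\<close>. Every prime divisor of \<open>M\<close> then divides exactly one of
  \<open>j\<close> and \<open>N * l\<close>, hence not their sum.\<close>

lemma coprime_lift:
  fixes j N M :: nat
  assumes "coprime j N" and "M > 0" and "N > 0"
  shows "\<exists>l. coprime (j + N * l) M \<and> j + N * l > 0"
proof -
  define S where "S = {p. prime p \<and> p dvd M \<and> \<not> p dvd j}"
  have fin: "finite S" unfolding S_def using \<open>M > 0\<close> by (intro finite_subset[OF _ finite_divisors_nat[of M]]) auto
  define l where "l = \<Prod>S"
  have l0: "l > 0" unfolding l_def S_def by (intro prod_pos) (auto simp: prime_gt_0_nat)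
  have "coprime (j + N * l) M"
  proof (rule ccontr)
    assume "\<not> coprime (j + N * l) M"
    then obtain p where p: "prime p" "p dvd j + N * l" "p dvd M"
      by (metis coprime_iff_gcd_eq_1 gcd_nat.bounded_iff prime_factor_nat)
    show False
    proof (cases "p dvd j")
      case True
      then have "p dvd N * l" using p by (simp add: dvd_add_right_iff)
      moreover have "\<not> p dvd N" using True assms(1) p(1) by (meson coprime_common_divisor not_prime_unit)
      ultimately have "p dvd l" using p(1) by (simp add: prime_dvd_mult_iff)
      then obtain r where "r \<in> S" "p dvd r" unfolding l_def using p(1) fin by (auto simp: prime_dvd_prod_iff)
      then have "r = p" using p(1) primes_dvd_imp_eq unfolding S_def by blast
      with \<open>r \<in> S\<close> True show False by (simp add: S_def)
    next
      case False
      then have "p dvd l" unfolding l_def using p fin by (intro dvd_prodI) (auto simp: S_def)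
      then have "p dvd j" using p(2) by (simp add: dvd_add_left_iff)
      with False show False by simp
    qed
  qed
  then show ?thesis using l0 \<open>N > 0\<close> by auto
qed

text \<open>The exponent matters only modulo \<open>n\<close>, so \<open>j\<close> may be replaced
  by a member of its residue class all of whose prime factors are large. The result for large primes
  is then applied to one factor after another.\<close>

theorem ipoly_root_conjugate:
  assumes n: "n > 0" and eta: "\<eta> ^ n = 1" and q: "ipoly q \<eta> = 0" and j: "coprime j n"
  shows "ipoly q (\<eta> ^ j) = 0"
proof -
  obtain B where B: "\<And>p \<eta> q. prime p \<Longrightarrow> p > B \<Longrightarrow> \<eta> ^ n = 1 \<Longrightarrow> ipoly q \<eta> = 0 \<Longrightarrow> ipoly q (\<eta> ^ p) = 0"
    using ipoly_root_power_large_prime[OF n] by blast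
  \<comment> \<open>Peeling off a prime \<open>p\<close> replaces \<eta> by
    \<open>\<eta> ^ p\<close>. The induction works because \<open>B\<close> is uniform over all
    \<open>n\<close>-th roots of unity.\<close>
  have large: "ipoly q (\<eta> ^ i) = 0"
    if "i > 0" "\<And>p. prime p \<Longrightarrow> p dvd i \<Longrightarrow> p > B" "\<eta> ^ n = 1" "ipoly q \<eta> = 0" for i \<eta>
    using that
  proof (induction i arbitrary: \<eta> rule: less_induct)
    case (less i)
    show ?case
    proof (cases "i = 1")
      case False
      then obtain p where p: "prime p" "p dvd i" using prime_factor_nat by blast
      then obtain i' where i': "i = p * i'" by (auto simp: dvd_def)
      have "i' < i" "i' > 0" using i' less.prems(1) p(1) prime_gt_1_nat by auto
      moreover have "(\<eta> ^ p) ^ n = 1" using less.prems(3) by (metis power_mult power_one mult.commute)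
      moreover have "ipoly q (\<eta> ^ p) = 0" using B p less.prems by blast
      ultimately have "ipoly q ((\<eta> ^ p) ^ i') = 0"
        using less.prems(2) i' less.IH[of i' "\<eta> ^ p"] by auto
      then show ?thesis by (simp add: i' power_mult)
    qed (use less.prems in simp)
  qed
  \<comment> \<open>Coprimality to the factorial of \<open>B\<close> excludes every prime factor up
    to \<open>B\<close>.\<close>
  obtain l where l: "coprime (j + n * l) (fact B)" "j + n * l > 0"
    using coprime_lift[OF j, of "fact B"] n by auto
  have "p > B" if p: "prime p" "p dvd j + n * l" for p
  proof (rule ccontr)
    assume "\<not> p > B"
    then have "p dvd fact B" using p(1) by (simp add: prime_dvd_fact_iff)
    then show False using l(1) p by (meson coprime_common_divisor not_prime_unit)
  qed
  then have "ipoly q (\<eta> ^ (j + n * l)) = 0" using l(2) eta q by (intro large) auto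
  then show ?thesis by (simp add: power_add power_mult eta)
qed

subsection \<open>The relation between two cosines\<close>

text \<open>Reducing the fraction \<open>l / n\<close> to \<open>t / N\<close> shows that \<zeta>
  has order \<open>N\<close>. An inverse of \<open>t\<close> modulo \<open>N\<close> sends \<zeta>
  to the first root; it is lifted to an exponent coprime to \<open>n\<close>, as conjugation of
  \<open>n\<close>-th roots of unity requires.\<close>

lemma root_of_unity_conjugate_to_first:
  assumes n: "n > 0" and zeta: "\<zeta> ^ n = 1"
  obtains N j where "N > 0" "coprime j n" "\<zeta> ^ j = cis (2 * pi / real N)" "\<zeta> ^ N = 1"
proof -
  have "\<zeta> \<in> (\<lambda>k. cis (2 * pi * real k / real n)) ` {..<n}"
    using bij_betw_roots_unity[OF n] zeta by (auto simp: bij_betw_def)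
  then obtain l where l: "\<zeta> = cis (2 * pi * real l / real n)" by blast
  define g where "g = gcd l n"
  obtain t N where tN: "l = g * t" "n = g * N" "coprime t N"
    using gcd_coprime_exists[of l n] n by (metis g_def gcd_eq_0_iff mult.commute not_gr_zero)
  have N: "N > 0" "g > 0" using n tN by auto
  have z: "\<zeta> = cis (2 * pi * real t / real N)" using N by (simp add: l tN ac_simps)
  obtain j0 where j0: "[t * j0 = 1] (mod N)" using cong_solve_coprime_nat[OF tN(3)] by auto
  then have "coprime (t * j0) N" using cong_imp_coprime cong_sym coprime_1_left by blast
  then have "coprime j0 N" by simp
  then obtain i where i: "coprime (j0 + N * i) n" using coprime_lift n N by blast
  have "[t * (j0 + N * i) = 1 + N * 0] (mod N)" using j0 by (simp add: cong_def algebra_simps)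
  then have "[1 = t * (j0 + N * i)] (mod N)" by (simp add: cong_sym)
  moreover have "\<zeta> ^ N = 1" using N by (simp add: z DeMoivre)
  moreover have "cis (2 * pi / real N) ^ N = 1" using N by (simp add: DeMoivre)
  ultimately have "cis (2 * pi / real N) ^ (t * (j0 + N * i)) = cis (2 * pi / real N)"
    by (metis (no_types, lifting) cong_def mod_mult_div_eq mult_1_right power_add power_mult power_one power_one_right)
  moreover have "\<zeta> = cis (2 * pi / real N) ^ t" by (simp add: z DeMoivre mult.commute)
  ultimately have "\<zeta> ^ (j0 + N * i) = cis (2 * pi / real N)" by (simp add: power_mult)
  with N i \<open>\<zeta> ^ N = 1\<close> show ?thesis using that by blast
qed

text \<open>On the unit circle this is twice the real part. The algebraic form is compatible with
  Galois conjugation.\<close>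

definition two_cos :: "complex \<Rightarrow> complex" where
  "two_cos z = z + inverse z"

lemma two_cos_unit:
  assumes "n > 0" "z ^ n = 1"
  shows "two_cos z = of_real (2 * Re z)" "\<bar>Re z\<bar> \<le> 1"
proof -
  have "norm z = 1" using assms
    by (metis norm_ge_zero norm_one norm_power power_eq_1_iff neq0_conv norm_of_nat)
  then have "inverse z = cnj z" by (metis complex_div_cnj inverse_eq_divide mult_1 div_by_1 of_real_1 power_one)
  then show "two_cos z = of_real (2 * Re z)" by (simp add: two_cos_def complex_eq_iff)
  show "\<bar>Re z\<bar> \<le> 1" using abs_Re_le_cmod[of z] \<open>norm z = 1\<close> by simp
qed

text \<open>The relation is conjugated so that the first root becomes exp(2 pi i/N). For N at least
  6 this gives 1 \<le> A < 2 and B \<le> 2, so (A - 1)(B - 1) < 1, whereas the relation makes this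
  product equal to 1.\<close>

lemma order_bound_of_unit_relation:
  fixes \<eta> :: complex
  assumes n: "n > 0" and eta: "\<eta> ^ n = 1"
    and rel: "two_cos (\<eta> ^ u) * two_cos (\<eta> ^ v) = two_cos (\<eta> ^ u) + two_cos (\<eta> ^ v)"
    and nz: "\<eta> ^ u \<noteq> 1"
  shows "\<exists>N\<in>{2,3,4,5}. (\<eta> ^ u) ^ N = 1"
proof -
  have "(\<eta> ^ u) ^ n = 1" using eta by (metis power_mult power_one mult.commute)
  then obtain N j where N: "N > 0" "coprime j n" "(\<eta> ^ u) ^ j = cis (2 * pi / real N)" "(\<eta> ^ u) ^ N = 1"
    using root_of_unity_conjugate_to_first[OF n] by metis
  \<comment> \<open>On \<open>n\<close>-th roots of unity the exponent \<open>(n - 1) * w\<close>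
    stands for \<open>-w\<close>, so \<open>m w\<close> represents \<open>two_cos (x ^ w)\<close> by
    a genuine polynomial.\<close>
  define m :: "nat \<Rightarrow> int poly" where "m w = Polynomial.monom 1 w + Polynomial.monom 1 ((n - 1) * w)" for w
  have m: "ipoly (m w) x = two_cos (x ^ w)" if "x ^ n = 1" for x w
  proof -
    have "x ^ (n - 1) * x = 1" using that n by (metis power_minus_mult)
    then have "x ^ (n - 1) = inverse x" by (metis inverse_unique mult.commute)
    then show ?thesis by (simp add: m_def two_cos_def hom_distribs poly_monom power_mult power_inverse)
  qed
  define q where "q = m u * m v - (m u + m v)"
  have q: "ipoly q x = two_cos (x ^ u) * two_cos (x ^ v) - (two_cos (x ^ u) + two_cos (x ^ v))" if "x ^ n = 1" for x
    using m[OF that] by (simp add: q_def hom_distribs)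
  have "ipoly q \<eta> = 0" using q[OF eta] rel by simp
  then have "ipoly q (\<eta> ^ j) = 0" by (rule ipoly_root_conjugate[OF n eta _ N(2)])
  moreover have root: "(\<eta> ^ w) ^ n = 1" for w using eta by (metis power_mult power_one mult.commute)
  ultimately have rel': "two_cos ((\<eta> ^ j) ^ u) * two_cos ((\<eta> ^ j) ^ v) = two_cos ((\<eta> ^ j) ^ u) + two_cos ((\<eta> ^ j) ^ v)"
    using q by simp
  define A where "A = 2 * cos (2 * pi / real N)"
  define B where "B = 2 * Re ((\<eta> ^ j) ^ v)"
  have "(\<eta> ^ j) ^ u = cis (2 * pi / real N)" using N(3) by (metis power_mult mult.commute)
  then have A: "two_cos ((\<eta> ^ j) ^ u) = of_real A" unfolding A_def
    using two_cos_unit[OF n, of "(\<eta> ^ j) ^ u"] root[of "j * u"] by (simp add: power_mult)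
  have B: "two_cos ((\<eta> ^ j) ^ v) = of_real B" "\<bar>B\<bar> \<le> 2" unfolding B_def
    using two_cos_unit[OF n, of "(\<eta> ^ j) ^ v"] root[of "j * v"] by (simp_all add: power_mult)
  have AB: "A * B = A + B"
    using rel' unfolding A B by (metis of_real_add of_real_mult of_real_eq_iff)
  have "N \<noteq> 1" using N(4) nz by auto
  moreover have "\<not> N \<ge> 6"
  proof
    assume N6: "N \<ge> 6"
    have "cos (pi / 3) \<le> cos (2 * pi / real N)"
      using N6 by (intro cos_monotone_0_pi_le) (auto simp: field_simps)
    then have "A \<ge> 1" by (simp add: A_def cos_60)
    moreover have "cos (2 * pi / real N) < cos 0"
      using N6 by (intro cos_monotone_0_pi) (auto simp: field_simps)
    then have "A < 2" by (simp add: A_def)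
    moreover have "(A - 1) * (B - 1) = 1" using AB by (simp add: algebra_simps)
    moreover have "(A - 1) * (B - 1) \<le> (A - 1) * 1" using \<open>A \<ge> 1\<close> B(2) by (intro mult_left_mono) auto
    ultimately show False by simp
  qed
  ultimately have "N \<in> {2,3,4,5}" using N(1) by auto
  then show ?thesis using N(4) by blast
qed

text \<open>Dividing the fifth cyclotomic equation by the square of \<open>x\<close> gives a
  quadratic in \<open>two_cos x\<close>, with roots (-1 + sqrt 5)/2 and (-1 - sqrt 5)/2.\<close>

lemma two_cos_fifth_root:
  assumes "x ^ 5 = 1" "x \<noteq> 1"
  shows "(two_cos x)\<^sup>2 + two_cos x = 1"
proof -
  have x0: "x \<noteq> 0" using assms by auto
  have "(x - 1) * (x ^ 4 + x ^ 3 + x\<^sup>2 + x + 1) = x ^ 5 - 1" by (simp add: algebra_simps eval_nat_numeral)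
  then have "x ^ 4 + x ^ 3 + x\<^sup>2 + x + 1 = 0" using assms by simp
  moreover have "x\<^sup>2 * ((two_cos x)\<^sup>2 + two_cos x - 1) = x ^ 4 + x ^ 3 + x\<^sup>2 + x + 1"
    using x0 unfolding two_cos_def by (simp add: field_simps eval_nat_numeral)
  ultimately show ?thesis using x0 by simp
qed

text \<open>Orders 4 and 5 also keep the equation for \<open>z\<close> itself, because these are the
  cases that survive in the classification and lead to divisibility conditions.\<close>

lemma two_cos_small_order:
  assumes "z ^ N = 1" "N \<in> {2,3,4,5}" "z \<noteq> 1"
  shows "two_cos z = -2 \<or> two_cos z = -1 \<or> (two_cos z = 0 \<and> z\<^sup>2 = -1) \<or>
    ((two_cos z)\<^sup>2 + two_cos z = 1 \<and> z ^ 5 = 1)"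
proof -
  have z0: "z \<noteq> 0" using assms by (auto simp: power_0_left)
  consider "z\<^sup>2 = 1" | "z ^ 3 = 1" | "z ^ 4 = 1" | "z ^ 5 = 1" using assms by auto
  then show ?thesis
  proof cases
    case 1
    then have "z = -1" using assms(3) by (simp add: power2_eq_1_iff)
    then show ?thesis by (simp add: two_cos_def)
  next
    case 2
    have "(z - 1) * (z\<^sup>2 + z + 1) = z ^ 3 - 1" by (simp add: algebra_simps eval_nat_numeral)
    then have "z\<^sup>2 + z + 1 = 0" using 2 assms(3) by simp
    then have "two_cos z = -1" using z0 unfolding two_cos_def by (simp add: field_simps power2_eq_square eq_neg_iff_add_eq_0)
    then show ?thesis by simp
  next
    case 3
    have "(z\<^sup>2) \<^sup>2 = 1" using 3 by (simp flip: power_mult)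
    then have "z\<^sup>2 = 1 \<or> z\<^sup>2 = -1" by (simp only: power2_eq_1_iff)
    then show ?thesis
    proof
      assume "z\<^sup>2 = 1"
      then have "z = -1" using assms(3) by (simp add: power2_eq_1_iff)
      then show ?thesis by (simp add: two_cos_def)
    next
      assume *: "z\<^sup>2 = -1"
      then have "two_cos z = 0" using z0 unfolding two_cos_def by (simp add: field_simps power2_eq_square)
      with * show ?thesis by simp
    qed
  next
    case 4
    then show ?thesis using two_cos_fifth_root assms(3) by simp
  qed
qed

lemma two_cos_eq_iff:
  assumes "z \<noteq> 0" "w \<noteq> 0"
  shows "two_cos z = two_cos w \<longleftrightarrow> z = w \<or> z * w = 1"
proof -
  have "z * w * (two_cos z - two_cos w) = (z - w) * (z * w - 1)"
    using assms unfolding two_cos_def by (simp add: field_simps)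
  then show ?thesis using assms by (metis eq_iff_diff_eq_0 mult_eq_0_iff)
qed

text \<open>Both roots have order at most 5, so only finitely many pairs of cosines need checking.
  In the last alternative the two cosines are the distinct roots of t^2 + t = 1.\<close>

lemma two_cos_relation_classification:
  fixes \<eta> :: complex
  assumes n: "n > 0" and eta: "\<eta> ^ n = 1"
    and rel: "two_cos (\<eta> ^ u) * two_cos (\<eta> ^ v) = two_cos (\<eta> ^ u) + two_cos (\<eta> ^ v)"
  shows "(\<eta> ^ u = 1 \<and> \<eta> ^ v = 1) \<or> ((\<eta> ^ u)\<^sup>2 = -1 \<and> (\<eta> ^ v)\<^sup>2 = -1) \<or>
    ((\<eta> ^ u) ^ 5 = 1 \<and> (\<eta> ^ v) ^ 5 = 1 \<and> \<eta> ^ u \<noteq> 1 \<and> \<eta> ^ v \<noteq> 1 \<and> \<eta> ^ u \<noteq> \<eta> ^ v \<and> \<eta> ^ u * \<eta> ^ v \<noteq> 1)"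
proof -
  define z w where "z = \<eta> ^ u" and "w = \<eta> ^ v"
  define A B where "A = two_cos z" and "B = two_cos w"
  have nz: "z \<noteq> 0" "w \<noteq> 0" using eta n by (auto simp: z_def w_def power_0_left)
  have AB: "A * B = A + B" using rel by (simp add: A_def B_def z_def w_def)
  have two: "two_cos x = 2 \<longleftrightarrow> x = 1" if "x \<noteq> 0" for x
    using two_cos_eq_iff[of x 1] that by (auto simp: two_cos_def)
  have "A = 2 \<longleftrightarrow> B = 2" using AB by auto
  then have iff1: "z = 1 \<longleftrightarrow> w = 1" using two nz by (simp add: A_def B_def)
  show ?thesis
  proof (cases "z = 1")
    case False
    obtain N where "N \<in> {2,3,4,5}" "z ^ N = 1"
      using order_bound_of_unit_relation[OF n eta rel] False unfolding z_def by blast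
    then have z: "A = -2 \<or> A = -1 \<or> (A = 0 \<and> z\<^sup>2 = -1) \<or> (A\<^sup>2 + A = 1 \<and> z ^ 5 = 1)"
      using two_cos_small_order False unfolding A_def by blast
    have "w \<noteq> 1" using False iff1 by simp
    moreover obtain N where "N \<in> {2,3,4,5}" "w ^ N = 1"
      using order_bound_of_unit_relation[OF n eta, of v u] rel \<open>w \<noteq> 1\<close> unfolding w_def
      by (auto simp: mult.commute add.commute)
    ultimately have w: "B = -2 \<or> B = -1 \<or> (B = 0 \<and> w\<^sup>2 = -1) \<or> (B\<^sup>2 + B = 1 \<and> w ^ 5 = 1)"
      using two_cos_small_order unfolding B_def by blast
    \<comment> \<open>The relation determines each cosine from the other. The values -2 and -1 would
      force the partners 2/3 and 1/2, which do not occur for orders 2 to 5.\<close>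
    have "A \<noteq> -2"
    proof
      assume "A = -2"
      then have "B = 2/3" using AB by (simp add: field_simps)
      from w[unfolded this] show False by (auto simp: power2_eq_square)
    qed
    moreover have "A \<noteq> -1"
    proof
      assume "A = -1"
      then have "B = 1/2" using AB by (simp add: field_simps)
      from w[unfolded this] show False by (auto simp: power2_eq_square)
    qed
    moreover have "B = 0" if "A = 0" using AB that by simp
    moreover have "A = 0" if "B = 0" using AB that by simp
    moreover have "B \<noteq> -2"
    proof
      assume "B = -2"
      then have "A = 2/3" using AB by (simp add: field_simps)
      from z[unfolded this] show False by (auto simp: power2_eq_square)
    qed
    moreover have "B \<noteq> -1"
    proof
      assume "B = -1"
      then have "A = 1/2" using AB by (simp add: field_simps)
      from z[unfolded this] show False by (auto simp: power2_eq_square)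
    qed
    ultimately consider "z\<^sup>2 = -1" "w\<^sup>2 = -1" | "A\<^sup>2 + A = 1" "z ^ 5 = 1" "w ^ 5 = 1"
      using z w by fastforce
    then show ?thesis
    proof cases
      case 1 then show ?thesis by (simp add: z_def w_def)
    next
      case 2
      \<comment> \<open>Equal cosines would be 0 or 2, and neither solves t^2 + t = 1. Distinct
        cosines exclude both \<open>z = w\<close> and \<open>z * w = 1\<close>.\<close>
      have "A \<noteq> B"
      proof
        assume "A = B"
        then have "A * A = 2 * A" using AB by simp
        then have "A = 0 \<or> A = 2" by auto
        then show False using 2(1) by auto
      qed
      then have "z \<noteq> w" "z * w \<noteq> 1" using two_cos_eq_iff[OF nz] unfolding A_def B_def by auto
      then show ?thesis using 2 False \<open>w \<noteq> 1\<close> by (simp add: z_def w_def)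
    qed
  qed (use iff1 in \<open>simp add: z_def w_def\<close>)
qed

text \<open>The two cosines are the distinct roots of t^2 + t - 1, so their sum and their product
  are both -1.\<close>

lemma two_cos_relation_order_5:
  assumes "z ^ 5 = 1" "w ^ 5 = 1" "z \<noteq> 1" "w \<noteq> 1" "z \<noteq> w" "z * w \<noteq> 1"
  shows "two_cos z * two_cos w = two_cos z + two_cos w"
proof -
  have nz: "z \<noteq> 0" "w \<noteq> 0" using assms by auto
  define A B where "A = two_cos z" and "B = two_cos w"
  have A: "A\<^sup>2 + A = 1" and B: "B\<^sup>2 + B = 1" using two_cos_fifth_root assms by (simp_all add: A_def B_def)
  have "(A - B) * (A + B + 1) = (A\<^sup>2 + A) - (B\<^sup>2 + B)" by (simp add: algebra_simps power2_eq_square)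
  moreover have "A \<noteq> B" using two_cos_eq_iff[OF nz] assms by (simp add: A_def B_def)
  ultimately have "A + B + 1 = 0" using A B by simp
  then have "B = - 1 - A" by (simp add: algebra_simps eq_neg_iff_add_eq_0)
  moreover have "A * (- 1 - A) = A + (- 1 - A)" using A by (simp add: algebra_simps power2_eq_square)
  ultimately show ?thesis by (simp only: A_def B_def)
qed

subsection \<open>Null spaces of graphs\<close>

lemma (in vec_space) span_singleton:
  assumes v: "v \<in> carrier_vec n"
  shows "span {v} = range (\<lambda>c. c \<cdot>\<^sub>v v)"
proof -
  have lc: "lincomb a {v} = a v \<cdot>\<^sub>v v" for a
  proof (rule eq_vecI)
    fix i assume "i < dim_vec (a v \<cdot>\<^sub>v v)"
    then have "i < n" using v by simp
    then show "lincomb a {v} $ i = (a v \<cdot>\<^sub>v v) $ i" using v by (subst lincomb_index) auto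
  qed (use v lincomb_dim[of "{v}"] in auto)
  show ?thesis
  proof (intro subset_antisym subsetI)
    fix x assume "x \<in> span {v}"
    then obtain a A where A: "A \<subseteq> {v}" "x = lincomb a A" unfolding span_def by auto
    then consider "A = {}" | "A = {v}" by blast
    then show "x \<in> range (\<lambda>c. c \<cdot>\<^sub>v v)"
    proof cases
      case 1
      then have "x = 0 \<cdot>\<^sub>v v" using A v by (simp add: lincomb_def) 
      then show ?thesis by blast
    next
      case 2
      then show ?thesis using A lc by auto
    qed
  next
    fix x assume "x \<in> range (\<lambda>c. c \<cdot>\<^sub>v v)"
    then obtain c where "x = lincomb (\<lambda>_. c) {v}" using lc by auto
    then show "x \<in> span {v}" unfolding span_def by auto
  qed
qed

text \<open>Null vectors are taken as functions on the vertices, which frees the later arguments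
  from the enumeration behind the matrix.\<close>

definition in_null_space :: "'v ugraph \<Rightarrow> ('v \<Rightarrow> real) \<Rightarrow> bool" where
  "in_null_space G f \<longleftrightarrow> (\<forall>x\<in>vertices G. (\<Sum>u | u \<in> vertices G \<and> {x, u} \<in> edges G. f u) = 0)"

text \<open>The enumeration \<open>e\<close> of the vertices translates functions into column
  vectors (\<open>vc\<close>) and back (\<open>fn\<close>), and matches neighbour sums with the rows
  of the matrix product. A kernel spanned by one nonzero vector has dimension one.\<close>

lemma nut_graph_iff:
  assumes simple: "simple_graph G" and ne: "vertices G \<noteq> {}"
  shows "nut_graph G \<longleftrightarrow> (\<exists>w. in_null_space G w \<and> (\<forall>x\<in>vertices G. w x \<noteq> 0) \<and>
    (\<forall>f. in_null_space G f \<longrightarrow> (\<exists>c. \<forall>x\<in>vertices G. f x = c * w x)))"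
proof -
  define V where "V = vertices G"
  define N where "N = card V"
  define e where "e = from_nat_into V"
  define A where "A = adjacency_matrix G"
  have fin: "finite V" using simple by (simp add: simple_graph_def V_def)
  have N: "N > 0" using fin ne by (simp add: N_def V_def card_gt_0_iff)
  have e: "bij_betw e {..<N} V" using bij_betw_from_nat_into_finite[OF fin] by (simp add: e_def N_def)
  have A: "A \<in> carrier_mat N N" by (simp add: A_def adjacency_matrix_def N_def V_def)
  have eV: "e i \<in> V" if "i < N" for i using e that by (auto simp: bij_betw_def)
  define vc where "vc f = vec N (\<lambda>i. f (e i) :: real)" for f
  define idx where "idx = the_inv_into {..<N} e"
  define fn where "fn v x = (v $ (idx x) :: real)" for v x
  have idx: "idx (e i) = i" if "i < N" for i
    unfolding idx_def using e that by (intro the_inv_into_f_f) (auto simp: bij_betw_def)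
  have vc_fn: "vc (fn v) = v" if "v \<in> carrier_vec N" for v
    using that by (intro eq_vecI) (auto simp: vc_def fn_def idx)
  have mult: "(A *\<^sub>v vc f) $ i = (\<Sum>u | u \<in> V \<and> {e i, u} \<in> edges G. f u)" if i: "i < N" for f i
  proof -
    have "(A *\<^sub>v vc f) $ i = (\<Sum>j<N. (if {e i, e j} \<in> edges G then f (e j) else 0))"
      using i A unfolding A_def adjacency_matrix_def vc_def
      by (auto simp: scalar_prod_def atLeast0LessThan e_def N_def V_def intro!: sum.cong)
    also have "\<dots> = (\<Sum>u\<in>V. if {e i, u} \<in> edges G then f u else 0)"
      by (rule sum.reindex_bij_betw[OF e])
    also have "\<dots> = (\<Sum>u | u \<in> V \<and> {e i, u} \<in> edges G. f u)"
      using fin by (subst sum.If_cases) (auto intro: sum.cong)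
    finally show ?thesis .
  qed
  have ker: "vc f \<in> mat_kernel A \<longleftrightarrow> in_null_space G f" for f
  proof -
    have "vc f \<in> mat_kernel A \<longleftrightarrow> (\<forall>i<N. (A *\<^sub>v vc f) $ i = 0)"
      unfolding mat_kernel[OF A] using A by (auto simp: vc_def vec_eq_iff)
    also have "\<dots> \<longleftrightarrow> (\<forall>x\<in>V. (\<Sum>u | u \<in> V \<and> {x, u} \<in> edges G. f u) = 0)"
      using e mult by (auto simp: bij_betw_def)
    finally show ?thesis by (simp add: in_null_space_def V_def)
  qed
  interpret kernel N N A by unfold_locales (rule A)
  have vc_eq: "vc f = c \<cdot>\<^sub>v vc w \<longleftrightarrow> (\<forall>x\<in>V. f x = c * w x)" for f w c
    using e by (auto simp: vc_def vec_eq_iff bij_betw_def)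
  have nut: "nut_graph G \<longleftrightarrow> kernel_dim A = 1 \<and>
     (\<exists>v \<in> carrier_vec N. mat_kernel A = NC.span {v} \<and> (\<forall>i<N. v $ i \<noteq> 0))"
    using simple by (simp add: nut_graph_def A_def N_def V_def)
  show ?thesis
  proof
    assume "nut_graph G"
    then obtain v where v: "v \<in> carrier_vec N" "mat_kernel A = NC.span {v}" "\<forall>i<N. v $ i \<noteq> 0"
      using nut by blast
    define w where "w = fn v"
    have vw: "v = vc w" using vc_fn v(1) by (simp add: w_def)
    have K: "mat_kernel A = range (\<lambda>c. c \<cdot>\<^sub>v vc w)"
      using NC.span_singleton v(1,2) vw by simp
    have "1 \<cdot>\<^sub>v vc w \<in> mat_kernel A" unfolding K by blast
    then have "in_null_space G w" using ker by simp
    moreover have "\<forall>x\<in>V. w x \<noteq> 0"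
      using v(3) e unfolding vw by (auto simp: vc_def bij_betw_def)
    moreover have "\<exists>c. \<forall>x\<in>V. f x = c * w x" if "in_null_space G f" for f
      using that vc_eq unfolding ker[symmetric] K by blast
    ultimately show "\<exists>w. in_null_space G w \<and> (\<forall>x\<in>vertices G. w x \<noteq> 0) \<and>
      (\<forall>f. in_null_space G f \<longrightarrow> (\<exists>c. \<forall>x\<in>vertices G. f x = c * w x))"
      unfolding V_def by blast
  next
    assume "\<exists>w. in_null_space G w \<and> (\<forall>x\<in>vertices G. w x \<noteq> 0) \<and>
      (\<forall>f. in_null_space G f \<longrightarrow> (\<exists>c. \<forall>x\<in>vertices G. f x = c * w x))"
    then obtain w where w: "in_null_space G w" "\<forall>x\<in>V. w x \<noteq> 0"
      "\<And>f. in_null_space G f \<Longrightarrow> \<exists>c. \<forall>x\<in>V. f x = c * w x"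
      unfolding V_def by blast
    have cw: "vc w \<in> carrier_vec N" by (simp add: vc_def)
    have wK: "vc w \<in> mat_kernel A" using w(1) ker by simp
    have "mat_kernel A = range (\<lambda>c. c \<cdot>\<^sub>v vc w)"
    proof safe
      fix v assume vK: "v \<in> mat_kernel A"
      then have "v \<in> carrier_vec N" using mat_kernelD[OF A] by blast
      then have "v = vc (fn v)" using vc_fn by simp
      with vK show "v \<in> range (\<lambda>c. c \<cdot>\<^sub>v vc w)" using w(3)[of "fn v"] ker vc_eq by (metis rangeI)
    qed (rule mat_kernel_smult[OF A wK])
    then have K: "mat_kernel A = NC.span {vc w}" using NC.span_singleton[OF cw] by simp
    have nz: "vc w $ i \<noteq> 0" if "i < N" for i using w(2) eV[OF that] that by (simp add: vc_def)
    have "vc w \<noteq> 0\<^sub>v N" using nz[OF N] N by auto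
    then have "dim = 1"
      using K wK span_same[of "{vc w}"] by (intro Ker.dim1I[of "vc w"]) auto
    then have "kernel_dim A = 1" by simp
    then show "nut_graph G" using nut K cw nz by blast
  qed
qed

subsection \<open>The spectrum of \<open>T4\<close>\<close>

text \<open>Indices are natural numbers, so subtracting \<open>c\<close> modulo \<open>n\<close> is
  written as adding \<open>n - c\<close>.\<close>

lemma add_mod_eq_iff:
  fixes i j c n :: nat
  assumes "i < n" "j < n" "c < n"
  shows "(i + c) mod n = j \<longleftrightarrow> i = (j + (n - c)) mod n"
  using assms by (auto simp: mod_if)

text \<open>These are the null space equations at \<open>X j\<close>, \<open>Y j\<close> and
  \<open>Z j\<close>. The value type is left open because the equations are solved over the complex
  numbers.\<close>

definition T4_system :: "nat \<Rightarrow> nat \<Rightarrow> nat \<Rightarrow> (t4_vertex \<Rightarrow> 'a::comm_monoid_add) \<Rightarrow> bool" where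
  "T4_system n a b f \<longleftrightarrow> (\<forall>j<n.
     f (X ((j + a) mod n)) + f (X ((j + (n - a)) mod n)) + f (Z j) = 0 \<and>
     f (Y ((j + b) mod n)) + f (Y ((j + (n - b)) mod n)) + f (Z j) = 0 \<and>
     f (X j) + f (Y j) + f (Z ((j + n div 2) mod n)) = 0)"

context
  fixes n m a b :: nat
  assumes n: "n = 2 * m" and a: "1 \<le> a" "a < m" and b: "1 \<le> b" "b < m"
begin

lemma vertices_T4: "vertices (T4 n a b) = X ` {..<n} \<union> Y ` {..<n} \<union> Z ` {..<n}"
  by (simp add: T4_def)

lemma simple_graph_T4: "simple_graph (T4 n a b)"
proof -
  have "(j + c) mod n \<noteq> j" if "j < n" "0 < c" "c < n" for j c
    using that by (auto simp: mod_if)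
  then have "(j + a) mod n \<noteq> j" "(j + b) mod n \<noteq> j" "(j + m) mod n \<noteq> j" if "j < n" for j
    using that a b n by auto
  then show ?thesis
    using a n unfolding simple_graph_def T4_def
    by (auto simp: doubleton_eq_iff) (metis (no_types, lifting) image_eqI lessThan_iff mod_less_divisor t4_vertex.inject not_gr_zero not_less_zero t4_vertex.distinct)+
qed

lemma X_neighbours:
  assumes j: "j < n"
  shows "{u. u \<in> vertices (T4 n a b) \<and> {X j, u} \<in> edges (T4 n a b)} =
    {X ((j + a) mod n), X ((j + (n - a)) mod n), Z j}"
proof -
  have n0: "n > 0" using j by simp
  have iff: "(i + a) mod n = j \<longleftrightarrow> i = (j + (n - a)) mod n" if "i < n" for i
    using that j a n by (intro add_mod_eq_iff) auto
  have "{X j, u} \<in> edges (T4 n a b) \<longleftrightarrow>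
      u = X ((j + a) mod n) \<or> (\<exists>i<n. (i + a) mod n = j \<and> u = X i) \<or> u = Z j" for u
    using j by (auto simp: T4_def doubleton_eq_iff)
  moreover have "(\<exists>i<n. (i + a) mod n = j \<and> u = X i) \<longleftrightarrow> u = X ((j + (n - a)) mod n)" for u
    using iff n0 by (metis mod_less_divisor)
  moreover have "X ((j + a) mod n) \<in> vertices (T4 n a b)" "X ((j + (n - a)) mod n) \<in> vertices (T4 n a b)"
    "Z j \<in> vertices (T4 n a b)"
    using j n0 by (simp_all add: vertices_T4)
  ultimately show ?thesis by auto
qed

lemma Y_neighbours:
  assumes j: "j < n"
  shows "{u. u \<in> vertices (T4 n a b) \<and> {Y j, u} \<in> edges (T4 n a b)} =
    {Y ((j + b) mod n), Y ((j + (n - b)) mod n), Z j}"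
proof -
  have n0: "n > 0" using j by simp
  have iff: "(i + b) mod n = j \<longleftrightarrow> i = (j + (n - b)) mod n" if "i < n" for i
    using that j b n by (intro add_mod_eq_iff) auto
  have "{Y j, u} \<in> edges (T4 n a b) \<longleftrightarrow>
      u = Y ((j + b) mod n) \<or> (\<exists>i<n. (i + b) mod n = j \<and> u = Y i) \<or> u = Z j" for u
    using j by (auto simp: T4_def doubleton_eq_iff)
  moreover have "(\<exists>i<n. (i + b) mod n = j \<and> u = Y i) \<longleftrightarrow> u = Y ((j + (n - b)) mod n)" for u
    using iff n0 by (metis mod_less_divisor)
  moreover have "Y ((j + b) mod n) \<in> vertices (T4 n a b)" "Y ((j + (n - b)) mod n) \<in> vertices (T4 n a b)"
    "Z j \<in> vertices (T4 n a b)"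
    using j n0 by (simp_all add: vertices_T4)
  ultimately show ?thesis by auto
qed

text \<open>The shift by \<open>n div 2\<close> is its own inverse modulo \<open>n\<close>, so
  forward and backward edges lead to the same neighbour among the \<open>Z\<close> vertices.\<close>

lemma Z_neighbours:
  assumes j: "j < n"
  shows "{u. u \<in> vertices (T4 n a b) \<and> {Z j, u} \<in> edges (T4 n a b)} =
    {X j, Y j, Z ((j + n div 2) mod n)}"
proof -
  have "(i + n div 2) mod n = j \<longleftrightarrow> i = (j + n div 2) mod n" if "i < n" for i
    using add_mod_eq_iff[OF that j, of "n div 2"] n a by simp
  moreover have "n > 0" using j by simp
  ultimately show ?thesis
    using j by (auto simp: T4_def doubleton_eq_iff)
qed

lemma in_null_space_T4: "in_null_space (T4 n a b) f \<longleftrightarrow> T4_system n a b f"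
proof -
  \<comment> \<open>From \<open>0 < 2 * c < n\<close> the forward and backward neighbours differ, so
    the sum over the neighbour set contains both terms.\<close>
  have ne: "(j + c) mod n \<noteq> (j + (n - c)) mod n" if "j < n" "1 \<le> c" "c < m" for j c
    using that n by (auto simp: mod_if)
  have "sum f {u. u \<in> vertices (T4 n a b) \<and> {X j, u} \<in> edges (T4 n a b)} =
      f (X ((j + a) mod n)) + f (X ((j + (n - a)) mod n)) + f (Z j)" if "j < n" for j
    using ne[OF that a] by (simp add: X_neighbours that add.assoc)
  moreover have "sum f {u. u \<in> vertices (T4 n a b) \<and> {Y j, u} \<in> edges (T4 n a b)} =
      f (Y ((j + b) mod n)) + f (Y ((j + (n - b)) mod n)) + f (Z j)" if "j < n" for j
    using ne[OF that b] by (simp add: Y_neighbours that add.assoc)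
  moreover have "sum f {u. u \<in> vertices (T4 n a b) \<and> {Z j, u} \<in> edges (T4 n a b)} =
      f (X j) + f (Y j) + f (Z ((j + n div 2) mod n))" if "j < n" for j
    by (simp add: Z_neighbours that add.assoc)
  ultimately show ?thesis
    unfolding in_null_space_def T4_system_def vertices_T4 by (auto simp: ball_Un)
qed

end

section \<open>Fourier analysis on the cyclic group of order n\<close>

lemma sum_cyclic_shift:
  fixes \<zeta> :: "'a::field" and g :: "nat \<Rightarrow> 'a"
  assumes n: "n > 0" and zeta: "\<zeta> ^ n = 1"
  shows "(\<Sum>j<n. g ((j + c) mod n) * \<zeta> ^ j) = inverse (\<zeta> ^ c) * (\<Sum>j<n. g j * \<zeta> ^ j)"
proof -
  note pow_mod = power_mod_root_of_unity[OF zeta]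
  have z0: "\<zeta> \<noteq> 0" using n zeta by (auto simp: power_0_left)
  have inj: "inj_on (\<lambda>j. (j + c) mod n) {..<n}"
  proof (rule inj_onI)
    fix i j assume "i \<in> {..<n}" "j \<in> {..<n}" "(i + c) mod n = (j + c) mod n"
    then have "[i + c = j + c] (mod n)" by (simp add: cong_def)
    then have "[i = j] (mod n)" by (simp add: cong_add_rcancel_nat)
    then show "i = j" using \<open>i \<in> _\<close> \<open>j \<in> _\<close> by (simp add: cong_def)
  qed
  moreover have "(\<lambda>j. (j + c) mod n) ` {..<n} \<subseteq> {..<n}" using n by auto
  ultimately have "bij_betw (\<lambda>j. (j + c) mod n) {..<n} {..<n}"
    by (simp add: bij_betw_def endo_inj_surj)
  then have "(\<Sum>j<n. g j * \<zeta> ^ j) = (\<Sum>j<n. g ((j + c) mod n) * \<zeta> ^ ((j + c) mod n))"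
    by (rule sum.reindex_bij_betw[symmetric])
  also have "\<dots> = \<zeta> ^ c * (\<Sum>j<n. g ((j + c) mod n) * \<zeta> ^ j)"
    by (simp add: pow_mod power_add sum_distrib_left ac_simps)
  finally show ?thesis using z0 by simp
qed

abbreviation unit_root :: "nat \<Rightarrow> complex" where
  "unit_root n \<equiv> cis (2 * pi / real n)"

lemma unit_root_power_eq_1_iff:
  assumes n: "n > 0"
  shows "unit_root n ^ l = 1 \<longleftrightarrow> n dvd l"
proof -
  have one: "unit_root n ^ n = 1" using n by (simp add: DeMoivre)
  then have red: "unit_root n ^ l = unit_root n ^ (l mod n)"
    by (simp add: power_mod_root_of_unity)
  have "inj_on (\<lambda>k. cis (2 * pi * real k / real n)) {..<n}"
    using bij_betw_roots_unity[OF n] by (simp add: bij_betw_def)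
  then have "cis (2 * pi * real (l mod n) / real n) = cis (2 * pi * real 0 / real n) \<longleftrightarrow> l mod n = 0"
    using n by (subst inj_on_eq_iff) auto
  then show ?thesis unfolding red by (simp add: DeMoivre dvd_eq_mod_eq_0 mult.commute)
qed

text \<open>Fourier inversion: orthogonality of characters expresses \<open>g i * of_nat n\<close>
  through the Fourier coefficients, and only the one at frequency 0 survives.\<close>

lemma constant_of_fourier_coefficients_0:
  fixes g :: "nat \<Rightarrow> complex"
  assumes n: "n > 0"
    and zero: "\<And>k. 0 < k \<Longrightarrow> k < n \<Longrightarrow> (\<Sum>j<n. g j * (unit_root n ^ k) ^ j) = 0"
    and i: "i < n"
  shows "g i = (\<Sum>j<n. g j) / of_nat n"
proof -
  define \<omega> where "\<omega> = unit_root n"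
  have w0: "\<omega> \<noteq> 0" by (simp add: \<omega>_def)
  \<comment> \<open>A geometric sum whose ratio is an \<open>n\<close>-th root of unity, equal to 1
    only for \<open>j = i\<close>.\<close>
  have orth: "(\<Sum>k<n. (\<omega> ^ j / \<omega> ^ i) ^ k) = (if j = i then of_nat n else 0)" if j: "j < n" for j
  proof (cases "j = i")
    case False
    have one: "\<omega> ^ n = 1" using unit_root_power_eq_1_iff[OF n] by (simp add: \<omega>_def)
    have "\<omega> ^ j \<noteq> \<omega> ^ i"
    proof
      assume "\<omega> ^ j = \<omega> ^ i"
      then have "\<omega> ^ (j + (n - i)) = \<omega> ^ (i + (n - i))" by (simp add: power_add)
      then have "\<omega> ^ (j + (n - i)) = 1" using one i by simp
      then have "n dvd j + (n - i)" unfolding \<omega>_def unit_root_power_eq_1_iff[OF n] .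
      then have "(j + (n - i)) mod n = 0" by simp
      then show False using i j False by (auto simp: mod_if split: if_splits)
    qed
    then have "\<omega> ^ j / \<omega> ^ i \<noteq> 1" using w0 by simp
    moreover have "(\<omega> ^ l) ^ n = 1" for l using one 
      by (metis mult.commute power_mult power_one)
    then have "(\<omega> ^ j / \<omega> ^ i) ^ n = 1" by (simp add: power_divide)
    ultimately show ?thesis using False by (simp add: geometric_sum)
  qed (use w0 in simp)
  have "(\<Sum>k<n. inverse ((\<omega> ^ k) ^ i) * (\<Sum>j<n. g j * (\<omega> ^ k) ^ j)) =
      (\<Sum>k<n. \<Sum>j<n. g j * (\<omega> ^ j / \<omega> ^ i) ^ k)"
    unfolding sum_distrib_left
    by (intro sum.cong refl) (simp add: power_divide field_simps w0 flip: power_mult)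
  also have "\<dots> = (\<Sum>j<n. g j * (\<Sum>k<n. (\<omega> ^ j / \<omega> ^ i) ^ k))"
    by (subst sum.swap) (simp add: sum_distrib_left)
  also have "\<dots> = (\<Sum>j<n. if j = i then g j * of_nat n else 0)"
    by (intro sum.cong refl) (simp add: orth)
  also have "\<dots> = g i * of_nat n" using i by simp
  finally have "g i * of_nat n = (\<Sum>k<n. inverse ((\<omega> ^ k) ^ i) * (\<Sum>j<n. g j * (\<omega> ^ k) ^ j))" by simp
  also have "\<dots> = (\<Sum>k<n. if k = 0 then (\<Sum>j<n. g j) else 0)"
    using zero by (intro sum.cong refl) (auto simp: \<omega>_def)
  also have "\<dots> = (\<Sum>j<n. g j)" using n by simp
  finally show ?thesis using n by (simp add: field_simps)
qed

lemma two_cos_signed: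
  assumes "s\<^sup>2 = 1"
  shows "two_cos (z * s) = s * two_cos z"
proof -
  have "s = 1 \<or> s = -1" using assms by (simp add: power2_eq_1_iff)
  then show ?thesis by (auto simp: two_cos_def)
qed

lemma T4_system_Re_Im:
  assumes "T4_system n a b F"
  shows "T4_system n a b (\<lambda>v. Re (F v))" "T4_system n a b (\<lambda>v. Im (F v))"
  using assms unfolding T4_system_def complex_eq_iff by simp_all

text \<open>On a character, the two neighbours at distance \<open>c\<close> act as multiplication by
  \<open>two_cos (\<zeta> ^ c)\<close> and the shift by \<open>m\<close> as multiplication by
  \<open>\<zeta> ^ m\<close>. The hypotheses \<open>eqs\<close> say that \<open>(p, q, r)\<close>
  lies in the kernel of the resulting 3 by 3 block.\<close>

lemma T4_system_character:
  fixes \<zeta> p q r :: complex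
  assumes n: "n = 2 * m" "n > 0" and zeta: "\<zeta> ^ n = 1" and ab: "a < n" "b < n"
    and eqs: "p * two_cos (\<zeta> ^ a) + r = 0" "q * two_cos (\<zeta> ^ b) + r = 0" "p + q + r * \<zeta> ^ m = 0"
  shows "T4_system n a b (case_t4_vertex (\<lambda>j. p * \<zeta> ^ j) (\<lambda>j. q * \<zeta> ^ j) (\<lambda>j. r * \<zeta> ^ j))"
proof -
  note pow_mod = power_mod_root_of_unity[OF zeta]
  have z0: "\<zeta> \<noteq> 0" using n zeta by (auto simp: power_0_left)
  have inv: "\<zeta> ^ (n - c) = inverse (\<zeta> ^ c)" if "c < n" for c
    using that z0 zeta by (simp add: power_diff inverse_eq_divide)
  have shift: "d * \<zeta> ^ ((j + c) mod n) + d * \<zeta> ^ ((j + (n - c)) mod n) + r * \<zeta> ^ j =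
      \<zeta> ^ j * (d * two_cos (\<zeta> ^ c) + r)" if "c < n" for c d j
    by (simp add: pow_mod power_add inv[OF that] two_cos_def algebra_simps)
  have "p * \<zeta> ^ j + q * \<zeta> ^ j + r * \<zeta> ^ ((j + m) mod n) = \<zeta> ^ j * (p + q + r * \<zeta> ^ m)" for j
    by (simp add: pow_mod power_add algebra_simps)
  then show ?thesis using eqs shift ab n unfolding T4_system_def by simp
qed

text \<open>A shift multiplies Fourier coefficients by an inverse power of \<zeta>. Since
  \<open>two_cos\<close> is invariant under inversion and \<open>\<zeta> ^ m\<close> is its own
  inverse, the same block appears as for characters.\<close>

lemma T4_system_fourier:
  fixes f :: "t4_vertex \<Rightarrow> complex"
  assumes n: "n = 2 * m" "n > 0" and zeta: "\<zeta> ^ n = 1" and ab: "a < n" "b < n"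
    and sys: "T4_system n a b f"
  defines "x \<equiv> \<Sum>j<n. f (X j) * \<zeta> ^ j" and "y \<equiv> \<Sum>j<n. f (Y j) * \<zeta> ^ j" and "z \<equiv> \<Sum>j<n. f (Z j) * \<zeta> ^ j"
  shows "two_cos (\<zeta> ^ a) * x + z = 0" "two_cos (\<zeta> ^ b) * y + z = 0" "x + y + \<zeta> ^ m * z = 0"
proof -
  have z0: "\<zeta> \<noteq> 0" using n zeta by (auto simp: power_0_left)
  have inv: "inverse (\<zeta> ^ (n - c)) = \<zeta> ^ c" if "c < n" for c
    using that z0 zeta by (simp add: power_diff)
  have inv': "inverse (\<zeta> ^ m) = \<zeta> ^ m" using zeta n by (intro inverse_unique) (simp add: mult_2 flip: power_add)
  note shift = sum_cyclic_shift[OF n(2) zeta]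
  have "(\<Sum>j<n. (f (X ((j + a) mod n)) + f (X ((j + (n - a)) mod n)) + f (Z j)) * \<zeta> ^ j) = 0"
    using sys by (intro sum.neutral) (simp add: T4_system_def)
  then show "two_cos (\<zeta> ^ a) * x + z = 0"
    using shift[of "\<lambda>j. f (X j)"] inv[OF ab(1)]
    by (simp add: distrib_right sum.distrib x_def z_def two_cos_def add.commute)
  have "(\<Sum>j<n. (f (Y ((j + b) mod n)) + f (Y ((j + (n - b)) mod n)) + f (Z j)) * \<zeta> ^ j) = 0"
    using sys by (intro sum.neutral) (simp add: T4_system_def)
  then show "two_cos (\<zeta> ^ b) * y + z = 0"
    using shift[of "\<lambda>j. f (Y j)"] inv[OF ab(2)]
    by (simp add: distrib_right sum.distrib y_def z_def two_cos_def add.commute)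
  have "(\<Sum>j<n. (f (X j) + f (Y j) + f (Z ((j + m) mod n))) * \<zeta> ^ j) = 0"
    using sys n by (intro sum.neutral) (simp add: T4_system_def)
  then show "x + y + \<zeta> ^ m * z = 0"
    using shift[of "\<lambda>j. f (Z j)"] inv'
    by (simp add: distrib_right sum.distrib x_def y_def z_def)
qed

text \<open>For \<open>u = a + m\<close> and \<open>v = b + m\<close> with \<open>n = 2 * m\<close>,
  this is the vanishing of the block determinant sAB - A - B, with the sign s absorbed into the
  exponents.\<close>

definition singular_frequency :: "nat \<Rightarrow> nat \<Rightarrow> nat \<Rightarrow> nat \<Rightarrow> bool" where
  "singular_frequency n u v k \<longleftrightarrow>
     two_cos ((unit_root n ^ k) ^ u) * two_cos ((unit_root n ^ k) ^ v) =
     two_cos ((unit_root n ^ k) ^ u) + two_cos ((unit_root n ^ k) ^ v)"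

lemma singular_frequency_shifted:
  fixes n m k a b :: nat
  assumes n: "n = 2 * m" "n > 0"
  defines "\<zeta> \<equiv> unit_root n ^ k"
  shows "singular_frequency n (a + m) (b + m) k \<longleftrightarrow>
    \<zeta> ^ m * two_cos (\<zeta> ^ a) * two_cos (\<zeta> ^ b) = two_cos (\<zeta> ^ a) + two_cos (\<zeta> ^ b)"
proof -
  define s where "s = \<zeta> ^ m"
  have "unit_root n ^ n = 1" using unit_root_power_eq_1_iff[OF n(2)] by simp
  then have "\<zeta> ^ n = 1" unfolding \<zeta>_def by (metis power_mult power_one mult.commute)
  then have s2: "s\<^sup>2 = 1" by (simp add: s_def n(1) power_mult mult.commute[of 2] )
  define A B where "A = two_cos (\<zeta> ^ a)" and "B = two_cos (\<zeta> ^ b)"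
  have "(s * A) * (s * B) - (s * A + s * B) = s * (s * A * B - (A + B))"
    by (simp add: algebra_simps)
  moreover have "s \<noteq> 0" using s2 by auto
  ultimately have "(s * A) * (s * B) = s * A + s * B \<longleftrightarrow> s * A * B = A + B"
    by (metis eq_iff_diff_eq_0 mult_eq_0_iff)
  then show ?thesis
    unfolding singular_frequency_def \<zeta>_def[symmetric] power_add s_def[symmetric] two_cos_signed[OF s2] A_def B_def .
qed

text \<open>A singular nontrivial block yields a solution along a nonconstant character, whereas
  every null vector of a nut graph is a multiple of \<open>e\<close>. Conversely, if all nontrivial
  blocks are regular, the \<open>X\<close> and \<open>Y\<close> parts of a solution are constant,
  and the equations make it a multiple of \<open>e\<close>.\<close>

lemma nut_graph_T4_iff:
  assumes n: "n = 2 * m" and a: "1 \<le> a" "a < m" and b: "1 \<le> b" "b < m"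
  shows "nut_graph (T4 n a b) \<longleftrightarrow> (\<forall>k. 0 < k \<and> k < n \<longrightarrow> \<not> singular_frequency n (a + m) (b + m) k)"
proof -
  have n0: "n > 0" "a < n" "b < n" using n a b by auto
  have root: "(unit_root n ^ k) ^ n = 1" for k
    using unit_root_power_eq_1_iff[OF n0(1)] by (metis dvd_refl power_mult power_one mult.commute)
  have V: "vertices (T4 n a b) = X ` {..<n} \<union> Y ` {..<n} \<union> Z ` {..<n}" by (simp add: T4_def)
  have nut: "nut_graph (T4 n a b) \<longleftrightarrow> (\<exists>w. T4_system n a b w \<and> (\<forall>x\<in>vertices (T4 n a b). w x \<noteq> 0) \<and>
    (\<forall>f. T4_system n a b f \<longrightarrow> (\<exists>c::real. \<forall>x\<in>vertices (T4 n a b). f x = c * w x)))"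
    using nut_graph_iff[OF simple_graph_T4[OF assms]] n0 unfolding in_null_space_T4[OF assms] V by blast
  define e :: "t4_vertex \<Rightarrow> real" where "e = case_t4_vertex (\<lambda>_. 1) (\<lambda>_. 1) (\<lambda>_. - 2)"
  have e: "T4_system n a b e" by (simp add: T4_system_def e_def)
  show ?thesis
  proof
    assume "nut_graph (T4 n a b)"
    then obtain w where w: "\<And>f. T4_system n a b f \<Longrightarrow> \<exists>c::real. \<forall>x\<in>vertices (T4 n a b). f x = c * w x"
      using nut by blast
    have const: "\<exists>c. \<forall>x\<in>vertices (T4 n a b). f x = c * e x" if f: "T4_system n a b f" for f
    proof -
      obtain c where c: "\<forall>x\<in>vertices (T4 n a b). f x = c * w x" using w[OF f] by blast
      obtain d where d: "\<forall>x\<in>vertices (T4 n a b). e x = d * w x" using w[OF e] by blast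
      have "X 0 \<in> vertices (T4 n a b)" using n0 by (simp add: V)
      then have "d \<noteq> 0" using d by (auto simp: e_def)
      then have "\<forall>x\<in>vertices (T4 n a b). f x = c / d * e x" using c d by simp
      then show ?thesis by blast
    qed
    \<comment> \<open>Indices 0 and 1 suffice: a character takes the values 1 and \<zeta> there, and
      \<zeta> differs from 1.\<close>
    have real_const: "f (X 1) = f (X 0) \<and> f (Y 1) = f (Y 0)" if "T4_system n a b f" for f :: "t4_vertex \<Rightarrow> real"
      using const[OF that] n a unfolding V by (auto simp: e_def ball_Un)
    have complex_const: "F (X 1) = F (X 0) \<and> F (Y 1) = F (Y 0)" if "T4_system n a b F" for F :: "t4_vertex \<Rightarrow> complex"
      using real_const[OF T4_system_Re_Im(1)[OF that]] real_const[OF T4_system_Re_Im(2)[OF that]]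
      by (simp add: complex_eq_iff)
    show "\<forall>k. 0 < k \<and> k < n \<longrightarrow> \<not> singular_frequency n (a + m) (b + m) k"
    proof (intro allI impI notI)
      fix k assume k: "0 < k \<and> k < n" and sing: "singular_frequency n (a + m) (b + m) k"
      define \<zeta> where "\<zeta> = unit_root n ^ k"
      define A B where "A = two_cos (\<zeta> ^ a)" and "B = two_cos (\<zeta> ^ b)"
      have rel: "\<zeta> ^ m * A * B = A + B"
        using sing singular_frequency_shifted[OF n n0(1)] unfolding A_def B_def \<zeta>_def by blast
      have z1: "\<zeta> \<noteq> 1" using k unit_root_power_eq_1_iff[OF n0(1), of k] by (auto simp: \<zeta>_def dest: dvd_imp_le)
      have triv: "p = 0 \<and> q = 0" if "p * A + r = 0" "q * B + r = 0" "p + q + r * \<zeta> ^ m = 0" for p q r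
      proof -
        have "p * \<zeta> = p" "q * \<zeta> = q"
          using complex_const[OF T4_system_character[OF n n0(1) root[of k] n0(2,3), folded \<zeta>_def, folded A_def B_def, OF that]]
          by simp_all
        then show ?thesis using z1 by simp
      qed
      \<comment> \<open>The vector \<open>(-B, -A, A * B)\<close> lies in the kernel of the singular
        block. If it gives nothing because \<open>A = B = 0\<close>, then \<open>(1, -1, 0)\<close>
        is a nonzero kernel vector.\<close>
      have "- B = 0 \<and> - A = 0"
        by (rule triv[of _ "A * B"]) (use rel in \<open>simp_all add: algebra_simps\<close>)
      then have "(1::complex) = 0 \<and> (- 1 :: complex) = 0" by (intro triv[of _ 0]) auto
      then show False by simp
    qed
  next
    assume nonsing: "\<forall>k. 0 < k \<and> k < n \<longrightarrow> \<not> singular_frequency n (a + m) (b + m) k"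
    have "\<exists>c. \<forall>x\<in>vertices (T4 n a b). f x = c * e x" if f: "T4_system n a b f" for f
    proof -
      define F where "F v = complex_of_real (f v)" for v
      have F: "T4_system n a b F"
        using f unfolding T4_system_def F_def by (simp flip: of_real_add)
      have zero: "(\<Sum>j<n. F (X j) * (unit_root n ^ k) ^ j) = 0 \<and> (\<Sum>j<n. F (Y j) * (unit_root n ^ k) ^ j) = 0"
        if k: "0 < k" "k < n" for k
      proof -
        define \<zeta> where "\<zeta> = unit_root n ^ k"
        define A B where "A = two_cos (\<zeta> ^ a)" and "B = two_cos (\<zeta> ^ b)"
        define x y z where "x = (\<Sum>j<n. F (X j) * \<zeta> ^ j)" and "y = (\<Sum>j<n. F (Y j) * \<zeta> ^ j)"
          and "z = (\<Sum>j<n. F (Z j) * \<zeta> ^ j)"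
        have rel: "\<zeta> ^ m * A * B \<noteq> A + B"
          using nonsing k singular_frequency_shifted[OF n n0(1)] unfolding A_def B_def \<zeta>_def by blast
        have eqs: "A * x + z = 0" "B * y + z = 0" "x + y + \<zeta> ^ m * z = 0"
          using T4_system_fourier[OF n n0(1) root[of k] n0(2,3) F]
          unfolding x_def y_def z_def A_def B_def \<zeta>_def by blast+
        \<comment> \<open>Eliminating \<open>x\<close> and \<open>y\<close> leaves the block
          determinant times \<open>z\<close>.\<close>
        have "z * (\<zeta> ^ m * A * B - (A + B)) = A * B * (x + y + \<zeta> ^ m * z) - B * (A * x + z) - A * (B * y + z)"
          by (simp add: algebra_simps)
        then have "z = 0" using eqs rel by simp
        \<comment> \<open>\<open>A\<close> and \<open>B\<close> cannot both vanish, since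
          \<open>rel\<close> would then read \<open>0 \<noteq> 0\<close>.\<close>
        then have "A * x = 0" "B * y = 0" "x + y = 0" "A \<noteq> 0 \<or> B \<noteq> 0" using eqs rel by auto
        then have "x = 0 \<and> y = 0" by auto
        then show ?thesis by (simp add: x_def y_def \<zeta>_def)
      qed
      define cx cy where "cx = f (X 0)" and "cy = f (Y 0)"
      have "F (X i) = (\<Sum>j<n. F (X j)) / of_nat n" if "i < n" for i
        using zero that by (intro constant_of_fourier_coefficients_0[OF n0(1)]) auto
      then have "F (X i) = F (X 0)" if "i < n" for i using that n0(1) by metis
      then have fx: "f (X i) = cx" if "i < n" for i
        unfolding F_def cx_def of_real_eq_iff using that .
      have "F (Y i) = (\<Sum>j<n. F (Y j)) / of_nat n" if "i < n" for i
        using zero that by (intro constant_of_fourier_coefficients_0[OF n0(1)]) auto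
      then have "F (Y i) = F (Y 0)" if "i < n" for i using that n0(1) by metis
      then have fy: "f (Y i) = cy" if "i < n" for i
        unfolding F_def cy_def of_real_eq_iff using that .
      have fz: "f (Z i) = - 2 * cx" "f (Z i) = - 2 * cy" if "i < n" for i
        using f that n0(1) unfolding T4_system_def by (auto simp: fx fy)
      have "cx = cy" using fz[OF n0(1)] by simp
      then have "\<forall>x\<in>vertices (T4 n a b). f x = cx * e x"
        using fx fy fz unfolding V by (auto simp: e_def)
      then show ?thesis by blast
    qed
    moreover have "\<forall>x\<in>vertices (T4 n a b). e x \<noteq> 0" by (simp add: e_def split: t4_vertex.split)
    ultimately show "nut_graph (T4 n a b)" using nut e by blast
  qed
qed

subsection \<open>Arithmetic of singular frequencies\<close>

text \<open>The three alternatives of the classification match the conditions. Both roots equal to 1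
  means a common factor of \<open>n\<close>, \<open>a + m\<close> and \<open>b + m\<close>; both
  squares equal to -1 requires \<open>m\<close> even and \<open>a\<close>, \<open>b\<close> odd;
  fifth roots give the condition at 5. The difference of \<open>a\<close> and \<open>b\<close> is
  formed in the integers, where it does not truncate.\<close>

lemma singular_frequency_exists_iff:
  fixes n m a b :: nat
  assumes n: "n = 2 * m" "m > 0" and ab: "a < m" "b < m"
  shows "(\<exists>k. 0 < k \<and> k < n \<and> singular_frequency n (a + m) (b + m) k) \<longleftrightarrow>
    \<not> (gcd m (gcd a b) = 1 \<and> (odd m \<longrightarrow> even a \<or> even b) \<and> (even m \<longrightarrow> even a \<noteq> even b) \<and>
      (5 dvd m \<longrightarrow> 5 dvd a \<or> 5 dvd b \<or> (5::int) dvd int a - int b \<or> 5 dvd a + b))"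
    (is "?L \<longleftrightarrow> \<not> ?R")
proof -
  define u v where "u = a + m" and "v = b + m"
  have n0: "n > 0" using n by simp
  define \<omega> where "\<omega> = unit_root n"
  have one: "\<omega> ^ l = 1 \<longleftrightarrow> n dvd l" for l
    unfolding \<omega>_def by (rule unit_root_power_eq_1_iff[OF n0])
  have w0: "\<omega> \<noteq> 0" by (simp add: \<omega>_def)
  have same: "\<omega> ^ i = \<omega> ^ j \<longleftrightarrow> int n dvd int i - int j" for i j
  proof -
    have le: "\<omega> ^ i = \<omega> ^ j \<longleftrightarrow> int n dvd int i - int j" if "j \<le> i" for i j
    proof -
      have "\<omega> ^ i = \<omega> ^ j * \<omega> ^ (i - j)" using that by (simp flip: power_add)
      then have "\<omega> ^ i = \<omega> ^ j \<longleftrightarrow> n dvd i - j" using w0 by (simp add: one)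
      then show ?thesis using that by (simp flip: of_nat_diff)
    qed
    show ?thesis
    proof (cases "j \<le> i")
      case False
      then show ?thesis using le[of i j] by (metis dvd_diff_commute nat_le_linear)
    qed (rule le)
  qed
  have "(\<omega> ^ m)\<^sup>2 = 1" using one[of n] by (simp add: n(1) mult.commute flip: power_mult)
  moreover have "\<omega> ^ m \<noteq> 1" using n by (auto simp: one dest: dvd_imp_le)
  ultimately have wm: "\<omega> ^ m = -1" by (simp add: power2_eq_1_iff)
  have sing: "singular_frequency n u v k \<longleftrightarrow>
    two_cos (\<omega> ^ (k * u)) * two_cos (\<omega> ^ (k * v)) = two_cos (\<omega> ^ (k * u)) + two_cos (\<omega> ^ (k * v))" for k
    by (simp add: singular_frequency_def \<omega>_def power_mult)
  have "\<not> ?R" if L: ?L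
  proof
    assume R: ?R
    obtain k where k: "0 < k" "k < n" "singular_frequency n u v k" using L unfolding u_def v_def by blast
    have "(\<omega> ^ k) ^ n = 1" by (simp add: one flip: power_mult)
    from two_cos_relation_classification[OF n0 this, of u v] k(3)[unfolded singular_frequency_def, folded \<omega>_def]
    consider "n dvd k * u" "n dvd k * v"
      | "(\<omega> ^ (k * u))\<^sup>2 = -1" "(\<omega> ^ (k * v))\<^sup>2 = -1"
      | "n dvd 5 * k * u" "n dvd 5 * k * v" "\<not> n dvd k * u" "\<not> n dvd k * v"
        "\<omega> ^ (k * u) \<noteq> \<omega> ^ (k * v)" "\<omega> ^ (k * u) * \<omega> ^ (k * v) \<noteq> 1"
      unfolding power_mult[symmetric] one by (force simp: ac_simps)
    then show False
    proof cases
      case 1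
      have "coprime n (gcd u v)"
      proof (rule ccontr)
        assume "\<not> coprime n (gcd u v)"
        then have "gcd n (gcd u v) \<noteq> 1" by (simp add: coprime_iff_gcd_eq_1)
        then obtain p where "prime p" "p dvd gcd n (gcd u v)" using prime_factor_nat by blast
        then have p: "prime p" "p dvd n" "p dvd u" "p dvd v" by simp_all
        show False
        \<comment> \<open>A common factor 2 means that \<open>a\<close>, \<open>b\<close> and
          \<open>m\<close> have the same parity, which the parity conditions exclude; an odd common
          prime contradicts the gcd condition.\<close>
        proof (cases "p = 2")
          case True
          then show False using p R by (auto simp: u_def v_def)
        next
          case False
          then have "p dvd m" using p n by (metis prime_dvd_mult_iff primes_dvd_imp_eq two_is_prime_nat)
          then have "p dvd a" "p dvd b" using p by (simp_all add: u_def v_def dvd_add_left_iff)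
          then have "p dvd gcd m (gcd a b)" using \<open>p dvd m\<close> by simp
          then show False using R p(1) by simp
        qed
      qed
      moreover have "n dvd k * gcd u v" using 1 by (simp add: gcd_mult_distrib_nat)
      ultimately have "n dvd k" by (simp add: coprime_dvd_mult_left_iff)
      then show False using k dvd_imp_le by fastforce
    next
      case 2
      \<comment> \<open>As \<open>\<omega> ^ m = -1\<close>, the hypothesis says that
        \<open>2 * (k * w)\<close> is congruent to \<open>m\<close> modulo \<open>2 * m\<close>, so
        it is an odd multiple of \<open>m\<close>.\<close>
      have odd_quot: "\<exists>s. 2 * (k * w) = m * s \<and> odd s" if "(\<omega> ^ (k * w))\<^sup>2 = -1" for w
      proof -
        have "\<omega> ^ (2 * (k * w)) = \<omega> ^ m" using that wm by (simp add: mult.commute flip: power_mult)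
        then have "\<omega> ^ (2 * (k * w) + m) = \<omega> ^ (m + m)" by (simp add: power_add)
        moreover have "\<omega> ^ (m + m) = 1" by (simp only: one n(1) mult_2 dvd_refl)
        ultimately have "n dvd 2 * (k * w) + m" by (simp only: one)
        then obtain t where t: "2 * (k * w) + m = 2 * m * t" using n by (auto simp: dvd_def)
        have "t > 0" using t n by (cases t) auto
        then have "2 * (k * w) = m * (2 * t - 1)" using t by (simp add: diff_mult_distrib2)
        then show ?thesis using \<open>t > 0\<close> by (intro exI[of _ "2 * t - 1"]) auto
      qed
      obtain s t where st: "2 * (k * u) = m * s" "odd s" "2 * (k * v) = m * t" "odd t"
        using odd_quot 2 by metis
      have "even m"
      proof -
        have "even (m * s)" using st(1) by (metis dvd_triv_left)
        then show ?thesis using st(2) by simp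
      qed
      have "m * (s * v) = m * (t * u)"
      proof -
        have "(m * s) * v = (m * t) * u" unfolding st(1,3)[symmetric] by (simp add: ac_simps)
        then show ?thesis by (simp only: mult.assoc)
      qed
      then have "s * v = t * u" using n(2) by simp
      then have "even v \<longleftrightarrow> even u" using st by (metis even_mult_iff)
      then show False using R \<open>even m\<close> by (simp add: u_def v_def)
    next
      case 3
      \<comment> \<open>The two roots are the powers \<open>s\<close> and \<open>t\<close> of exp(2
        pi i/5). The remaining hypotheses say that 5 divides none of \<open>s\<close>,
        \<open>t\<close>, \<open>s + t\<close>, \<open>s - t\<close>.\<close>
      obtain s t where st: "5 * k * u = n * s" "5 * k * v = n * t" using 3(1,2) by (auto simp: dvd_def)
      have s5: "\<not> 5 dvd s"
      proof
        assume "5 dvd s"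
        then obtain s' where "s = 5 * s'" by (auto simp: dvd_def)
        then have "k * u = n * s'" using st(1) by simp
        then show False using 3(3) by simp
      qed
      have t5: "\<not> 5 dvd t"
      proof
        assume "5 dvd t"
        then obtain t' where "t = 5 * t'" by (auto simp: dvd_def)
        then have "k * v = n * t'" using st(2) by simp
        then show False using 3(4) by simp
      qed
      have plus: "\<not> 5 dvd s + t"
      proof
        assume "5 dvd s + t"
        then obtain r where r: "s + t = 5 * r" by (auto simp: dvd_def)
        have "5 * (k * u + k * v) = n * (s + t)" using st by (simp add: algebra_simps)
        then have "k * u + k * v = n * r" using r by simp
        then have "n dvd k * u + k * v" by simp
        then show False using 3(6) one by (simp flip: power_add)
      qed
      have minus: "\<not> (5::int) dvd int s - int t"
      proof
        assume "(5::int) dvd int s - int t"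
        then obtain r where r: "int s - int t = 5 * r" by (auto simp: dvd_def)
        have "5 * (int (k * u) - int (k * v)) = int (5 * k * u) - int (5 * k * v)" by simp
        also have "\<dots> = int n * (int s - int t)" unfolding st by (simp add: algebra_simps)
        finally have "int (k * u) - int (k * v) = int n * r" using r by simp
        then show False using 3(5) same by simp
      qed
      have p5: "prime (5::nat)" "prime (5::int)" by simp_all
      have "5 dvd n * s" using st(1) by (metis dvd_triv_left mult.assoc)
      then have "5 dvd n" using s5 p5 by (simp add: prime_dvd_mult_iff)
      then have m5: "5 dvd m" unfolding n(1) using p5(1) by (subst (asm) prime_dvd_mult_iff) auto
      \<comment> \<open>Eliminating \<open>k\<close> gives \<open>s * v = t * u\<close>, which
        carries divisibility by 5 from \<open>u\<close> and \<open>v\<close> over to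
        \<open>s\<close> and \<open>t\<close>.\<close>
      have "n * (s * v) = n * (t * u)"
      proof -
        have "(n * s) * v = (n * t) * u" unfolding st[symmetric] by (simp add: ac_simps)
        then show ?thesis by (simp only: mult.assoc)
      qed
      then have sv: "s * v = t * u" using n0 by simp
      have ab5: "5 dvd a \<longleftrightarrow> 5 dvd u" "5 dvd b \<longleftrightarrow> 5 dvd v"
        using m5 by (simp_all add: u_def v_def dvd_add_left_iff)
      have uv5: "5 dvd u \<longleftrightarrow> 5 dvd v"
        using sv s5 t5 p5(1) by (metis prime_dvd_mult_iff)
      have not5: "\<not> 5 dvd v"
      proof
        assume "5 dvd v"
        then have "5 dvd gcd m (gcd a b)" using m5 ab5 uv5 by simp
        then show False using R by simp
      qed
      then have not5': "\<not> (5::int) dvd int v"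
        by (metis int_dvd_int_iff of_nat_numeral)
      have isv: "int s * int v = int t * int u" using sv by (metis of_nat_mult)
      consider "(5::int) dvd int a - int b" | "5 dvd a + b"
        using R m5 ab5 uv5 not5 by blast
      then show False
      proof cases
        case 1
        then have "(5::int) dvd (int u - int v) * int t" by (simp add: u_def v_def)
        also have "(int u - int v) * int t = int v * (int s - int t)" using isv by (simp add: algebra_simps)
        finally show False using minus not5' p5(2) by (simp add: prime_dvd_mult_iff)
      next
        case 2
        then have "5 dvd (a + b) + 2 * m" using m5 by simp
        moreover have "u + v = (a + b) + 2 * m" by (simp add: u_def v_def)
        ultimately have "5 dvd (u + v) * t" by simp
        also have "(u + v) * t = v * (s + t)" using sv by (simp add: algebra_simps)
        finally show False using plus not5 p5(1) by (simp add: prime_dvd_mult_iff)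
      qed
    qed
  qed
  moreover have ?L if nR: "\<not> ?R"
  proof -
    have trivial: "singular_frequency n u v k" if "n dvd k * u" "n dvd k * v" for k
    proof -
      have "\<omega> ^ (k * u) = 1" "\<omega> ^ (k * v) = 1" using that by (simp_all only: one)
      then show ?thesis unfolding sing by (simp add: two_cos_def)
    qed
    have "\<exists>k. 0 < k \<and> k < n \<and> singular_frequency n u v k"
    proof -
      \<comment> \<open>\<open>u\<close> and \<open>v\<close> are both even exactly when
        \<open>a\<close>, \<open>b\<close> and \<open>m\<close> share their parity; this covers
        \<open>a\<close>, \<open>b\<close> odd for odd \<open>m\<close> and \<open>a\<close>,
        \<open>b\<close> even for even \<open>m\<close>. The witnesses in the four cases are n/p,
        n/2, n/4 and n/5.\<close>
      consider "gcd m (gcd a b) \<noteq> 1" | "even u" "even v" | "odd u" "odd v" "even m"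
        | "5 dvd m" "\<not> 5 dvd a" "\<not> 5 dvd b" "\<not> (5::int) dvd int a - int b" "\<not> 5 dvd a + b"
        using nR unfolding u_def v_def by auto
      then show ?thesis
      proof cases
        case 1
        then obtain p where "prime p" "p dvd gcd m (gcd a b)" using prime_factor_nat by blast
        then have p: "prime p" "p dvd m" "p dvd a" "p dvd b" by simp_all
        then have p': "p dvd n" "p dvd u" "p dvd v" using n by (simp_all add: u_def v_def)
        obtain k where k: "n = p * k" using p' by (auto simp: dvd_def)
        have "p > 1" using p(1) prime_gt_1_nat by blast
        then have "0 < k" "k < n" using k n0 by auto
        moreover have "n dvd k * u" "n dvd k * v" using p' by (simp_all add: k mult.commute[of p])
        ultimately show ?thesis using trivial by blast
      next
        case 2
        then have "n dvd m * u" "n dvd m * v" by (simp_all add: n(1) mult.commute[of 2])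
        then show ?thesis using trivial n by (intro exI[of _ m]) auto
      next
        case 3
        obtain h where h: "m = 2 * h" using 3(3) by blast
        \<comment> \<open>At frequency n/4 an odd exponent gives a square root of -1, so both
          cosines vanish and the relation reads 0 = 0.\<close>
        have "two_cos (\<omega> ^ (h * w)) = 0" if "odd w" for w
        proof -
          have "\<omega> ^ (h * w) * \<omega> ^ (h * w) = \<omega> ^ (m * w)"
            by (simp add: h mult_2 distrib_right power_add)
          also have "\<dots> = (\<omega> ^ m) ^ w" by (rule power_mult)
          also have "\<dots> = -1" using that by (simp add: wm)
          finally have "inverse (\<omega> ^ (h * w)) = - (\<omega> ^ (h * w))" by (intro inverse_unique) simp
          then show ?thesis by (simp add: two_cos_def)
        qed
        then have "singular_frequency n u v h" using 3 sing by simp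
        then show ?thesis using h n by (intro exI[of _ h]) auto
      next
        case 4
        have "5 dvd n" using 4(1) n(1) by simp
        then obtain k where k: "n = 5 * k" by (rule dvdE)
        have k0: "0 < k" "k < n" using k n0 by auto
        have red: "n dvd k * l \<longleftrightarrow> 5 dvd l" for l using k0 by (simp add: k mult.commute)
        have fifth: "(\<omega> ^ (k * w)) ^ 5 = 1" for w by (simp add: one k flip: power_mult)
        have "\<not> 5 dvd u" "\<not> 5 dvd v" using 4 by (simp_all add: u_def v_def dvd_add_left_iff)
        then have "\<omega> ^ (k * u) \<noteq> 1" "\<omega> ^ (k * v) \<noteq> 1" by (simp_all add: one red)
        moreover have "\<omega> ^ (k * u) * \<omega> ^ (k * v) \<noteq> 1"
        proof
          assume "\<omega> ^ (k * u) * \<omega> ^ (k * v) = 1"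
          then have "\<omega> ^ (k * (u + v)) = 1" by (simp add: distrib_left power_add)
          then have "5 dvd u + v" by (simp only: one red)
          moreover have "u + v = (a + b) + 2 * m" by (simp add: u_def v_def)
          ultimately show False using 4 by (simp add: dvd_add_left_iff)
        qed
        moreover have "\<omega> ^ (k * u) \<noteq> \<omega> ^ (k * v)"
        proof
          assume "\<omega> ^ (k * u) = \<omega> ^ (k * v)"
          then have "int n dvd int (k * u) - int (k * v)" by (simp only: same)
          moreover have "int n = int k * 5" by (simp add: k)
          moreover have "int (k * u) - int (k * v) = int k * (int u - int v)" by (simp add: right_diff_distrib)
          ultimately have "5 dvd int u - int v" using k0 by simp
          then show False using 4 by (simp add: u_def v_def)
        qed
        ultimately have "singular_frequency n u v k"
          unfolding sing using two_cos_relation_order_5 fifth by blast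
        then show ?thesis using k0 by blast
      qed
    qed
    then show ?thesis by (simp add: u_def v_def)
  qed
  ultimately show ?thesis by (rule iffI)
qed

theorem theorem6p1:
  fixes n a b :: nat
  assumes "even n"
    and "1 \<le> a" and "a < n div 2"
    and "1 \<le> b" and "b < n div 2"
  shows "nut_graph (T4 n a b) \<longleftrightarrow>
    gcd (n div 2) (gcd a b) = 1 \<and>
    (\<not> 4 dvd n \<longrightarrow> even a \<or> even b) \<and>
    (4 dvd n \<longrightarrow> even a \<noteq> even b) \<and>
    (10 dvd n \<longrightarrow> 5 dvd a \<or> 5 dvd b \<or> (5::int) dvd int a - int b \<or> 5 dvd a + b)"
proof -
  obtain m where n: "n = 2 * m" using assms(1) by blast
  have ab: "1 \<le> a" "a < m" "1 \<le> b" "b < m" "m > 0" using assms n by auto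
  have dvd: "4 dvd n \<longleftrightarrow> even m" "10 dvd n \<longleftrightarrow> 5 dvd m" "n div 2 = m" unfolding n by presburger+
  have "nut_graph (T4 n a b) \<longleftrightarrow> \<not> (\<exists>k. 0 < k \<and> k < n \<and> singular_frequency n (a + m) (b + m) k)"
    unfolding nut_graph_T4_iff[OF n ab(1-4)] by blast
  then show ?thesis
    unfolding dvd singular_frequency_exists_iff[OF n ab(5,2,4)] not_not .
qed

end
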